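(* Let $(X,\mu)$, $(Y,\nu)$, $(X_1,\mu_1)$ and $(Y_1,\nu_1)$ be standard Borel spaces with ($\sigma$-finite) measures, and let $\varphi:X\to X_1$, $\psi:Y\to Y_1$ be Borel mappings. Suppose that the push-forward measures $\varphi_*\mu$ and $\psi_*\nu$ are absolutely continuous with respect to $\mu_1$ and $\nu_1$ respectively. If a Borel set $E_1\subseteq X_1\times Y_1$ is a set of $\mu_1\times\nu_1$-synthesis, then $(\varphi\times\psi)^{-1}(E_1)$ is a set of $\mu\times\nu$-synthesis.
   Context: Definitions for a pair $(X,\mu),(Y,\nu)$ of standard Borel spaces with $\sigma$-finite measures (and likewise for $(X_1,\mu_1),(Y_1,\nu_1)$). A subset of $X\times Y$ is marginally null if it is contained in $(N\times Y)\cup(X\times M)$ with $\mu(N)=\nu(M)=0$; "m.a.e." means outside a marginally null set. A set is pseudo-open if, up to a marginally null set, it is a countable union of measurable rectangles $A\times B$; pseudo-closed sets are complements of pseudo-open sets. $\Gamma(X,Y)=L_2(X,\mu)\hat\otimes L_2(Y,\nu)$ is the space of functions (identified when equal m.a.e.) $F(x,y)=\sum_{n}f_n(x)g_n(y)$ with $f_n\in L_2(X,\mu)$, $g_n\in L_2(Y,\nu)$, $\sum_n\|f_n\|\|g_n\|<\infty$, normed by $\|F\|_\Gamma=\inf\sum_n\|f_n\|\|g_n\|$. $F$ vanishes on $K$ if $F\chi_K=0$ m.a.e. $\Phi(K)$ is the set of $F\in\Gamma(X,Y)$ vanishing on $K$; $\Phi_0(K)$ is the norm closure of the set of $F\in\Gamma(X,Y)$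 vanishing on some pseudo-open set containing $K$. A set $K$ is a set of $\mu\times\nu$-synthesis if it is pseudo-closed and $\Phi_0(K)=\Phi(K)$. *)

theory Defs
  imports "HOL-Analysis.Analysis"
begin

text \<open>A measure whose \<open>\<sigma>\<close>-algebra is the Borel \<open>\<sigma>\<close>-algebra of some Polish topology on its
  underlying set. Only \<open>space M\<close> and \<open>sets M\<close> matter, and the measure is not completed.\<close>

definition standard_borel :: "'a measure \<Rightarrow> bool" where
  "standard_borel M \<longleftrightarrow>
     (\<exists>T. topspace T = space M \<and> completely_metrizable_space T \<and> second_countable T \<and>
          sets M = sigma_sets (space M) {U. openin T U})"

definition marginally_null :: "'a measure \<Rightarrow> 'b measure \<Rightarrow> ('a \<times> 'b) set \<Rightarrow> bool" where
  "marginally_null M N E \<longleftrightarrow>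
     E \<subseteq> space M \<times> space N \<and>
     (\<exists>A \<in> null_sets M. \<exists>B \<in> null_sets N. E \<subseteq> A \<times> space N \<union> space M \<times> B)"

definition mae :: "'a measure \<Rightarrow> 'b measure \<Rightarrow> ('a \<times> 'b \<Rightarrow> bool) \<Rightarrow> bool" where
  "mae M N P \<longleftrightarrow> marginally_null M N {p \<in> space M \<times> space N. \<not> P p}"

definition pseudo_open :: "'a measure \<Rightarrow> 'b measure \<Rightarrow> ('a \<times> 'b) set \<Rightarrow> bool" where
  "pseudo_open M N E \<longleftrightarrow>
     E \<subseteq> space M \<times> space N \<and>
     (\<exists>(A :: nat \<Rightarrow> 'a set) (B :: nat \<Rightarrow> 'b set).
        (\<forall>n. A n \<in> sets M \<and> B n \<in> sets N) \<and>
        marginally_null M N ((E - (\<Union>n. A n \<times> B n)) \<union> ((\<Union>n. A n \<times> B n) - E)))"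

definition pseudo_closed :: "'a measure \<Rightarrow> 'b measure \<Rightarrow> ('a \<times> 'b) set \<Rightarrow> bool" where
  "pseudo_closed M N E \<longleftrightarrow>
     E \<subseteq> space M \<times> space N \<and> pseudo_open M N (space M \<times> space N - E)"

definition L2 :: "'a measure \<Rightarrow> ('a \<Rightarrow> complex) set" where
  "L2 M = {f \<in> borel_measurable M. integrable M (\<lambda>x. (cmod (f x))\<^sup>2)}"

definition L2_norm :: "'a measure \<Rightarrow> ('a \<Rightarrow> complex) \<Rightarrow> real" where
  "L2_norm M f = sqrt (LINT x|M. (cmod (f x))\<^sup>2)"

text \<open>Elements of \<open>L\<^sub>2\<close> and of \<open>\<Gamma>\<close> are represented by functions; nothing below
  distinguishes functions that agree almost everywhere, respectively m.a.e.\<close>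

definition Gamma_rep ::
    "'a measure \<Rightarrow> 'b measure \<Rightarrow> ('a \<times> 'b \<Rightarrow> complex) \<Rightarrow>
     (nat \<Rightarrow> 'a \<Rightarrow> complex) \<Rightarrow> (nat \<Rightarrow> 'b \<Rightarrow> complex) \<Rightarrow> bool" where
  "Gamma_rep M N F f g \<longleftrightarrow>
     (\<forall>n. f n \<in> L2 M \<and> g n \<in> L2 N) \<and>
     summable (\<lambda>n. L2_norm M (f n) * L2_norm N (g n)) \<and>
     mae M N (\<lambda>(x, y). (\<lambda>n. f n x * g n y) sums F (x, y))"

definition Gamma_space :: "'a measure \<Rightarrow> 'b measure \<Rightarrow> ('a \<times> 'b \<Rightarrow> complex) set" where
  "Gamma_space M N = {F. \<exists>f g. Gamma_rep M N F f g}"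

definition Gamma_norm :: "'a measure \<Rightarrow> 'b measure \<Rightarrow> ('a \<times> 'b \<Rightarrow> complex) \<Rightarrow> real" where
  "Gamma_norm M N F =
     Inf {(\<Sum>n. L2_norm M (f n) * L2_norm N (g n)) | f g. Gamma_rep M N F f g}"

definition Gamma_closure ::
    "'a measure \<Rightarrow> 'b measure \<Rightarrow> ('a \<times> 'b \<Rightarrow> complex) set \<Rightarrow> ('a \<times> 'b \<Rightarrow> complex) set" where
  "Gamma_closure M N S =
     {F \<in> Gamma_space M N. \<forall>e>0. \<exists>G\<in>S. Gamma_norm M N (\<lambda>p. F p - G p) < e}"

definition vanishes_on ::
    "'a measure \<Rightarrow> 'b measure \<Rightarrow> ('a \<times> 'b \<Rightarrow> complex) \<Rightarrow> ('a \<times> 'b) set \<Rightarrow> bool" where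
  "vanishes_on M N F K \<longleftrightarrow> mae M N (\<lambda>p. F p * indicator K p = 0)"

definition Phi :: "'a measure \<Rightarrow> 'b measure \<Rightarrow> ('a \<times> 'b) set \<Rightarrow> ('a \<times> 'b \<Rightarrow> complex) set" where
  "Phi M N K = {F \<in> Gamma_space M N. vanishes_on M N F K}"

definition Phi0 :: "'a measure \<Rightarrow> 'b measure \<Rightarrow> ('a \<times> 'b) set \<Rightarrow> ('a \<times> 'b \<Rightarrow> complex) set" where
  "Phi0 M N K =
     Gamma_closure M N {F \<in> Gamma_space M N. \<exists>U. pseudo_open M N U \<and> K \<subseteq> U \<and> vanishes_on M N F U}"

definition synthesis_set :: "'a measure \<Rightarrow> 'b measure \<Rightarrow> ('a \<times> 'b) set \<Rightarrow> bool" where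
  "synthesis_set M N K \<longleftrightarrow> pseudo_closed M N K \<and> Phi0 M N K = Phi M N K"

end

theory Submission
  imports Defs
begin

text \<open>
  Write the elements of \<open>\<Gamma>\<close> as \<open>F(x, y) = \<langle>f x, g y\<rangle>\<close> with square integrable \<open>\<ell>\<^sup>2\<close>-valued
  functions \<open>f\<close> and \<open>g\<close>, where \<open>\<langle>a, b\<rangle>\<close> is the bilinear pairing \<open>\<Sum>n. a n * b n\<close>; the norm
  of \<open>\<Gamma>\<close> is governed by the energies \<open>\<integral>\<parallel>f\<parallel>\<^sup>2\<close> and \<open>\<integral>\<parallel>g\<parallel>\<^sup>2\<close> (\<open>Gamma_norm_less_iff\<close>).

  Let \<open>F\<close> vanish on the inverse image of \<open>E1\<close>. The idea is to approximate \<open>f\<close>, in energy, by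
  functions \<open>f'\<close> whose value at \<open>x\<close> is the value of \<open>f\<close> at a selected point of the same fibre
  of \<open>\<phi>\<close>: \<open>f' x = f (s j (\<phi> x))\<close> for \<open>x\<close> in one of finitely many disjoint pieces \<open>A j\<close>, and
  \<open>f' x = 0\<close> on the small remainder. Here \<open>s j\<close> is a measurable
  section of \<open>\<phi>\<close> with values in a set on which \<open>f\<close> oscillates little. Let \<open>g'\<close> be built from sections \<open>t l\<close> of \<open>\<psi>\<close> over pieces \<open>B l\<close> in the same
  way. Then \<open>\<langle>f' x, g' y\<rangle>\<close> is the finite sum over \<open>j\<close> and \<open>l\<close> of
  \<open>indicator (A j) x * indicator (B l) y * G j l (\<phi> x, \<psi> y)\<close>, with
  \<open>G j l (u, v) = \<langle>f (s j u), g (t l v)\<rangle>\<close>. The point \<open>(s j u, t l v)\<close> lies over \<open>(u, v)\<close>, so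
  \<open>G j l\<close> vanishes on \<open>E1\<close> at every point and not merely in an averaged sense. By synthesis of \<open>E1\<close>
  it lies in \<open>\<Phi>\<^sub>0 E1\<close>, and pulling back along \<open>\<phi> \<times> \<psi>\<close> maps \<open>\<Phi>\<^sub>0 E1\<close> into \<open>\<Phi>\<^sub>0\<close> of the
  inverse image (\<open>Phi0_pullback\<close>), which is a closed subspace (\<open>Phi0_sum\<close>, \<open>Phi0_closed\<close>).

  Two facts of measure theory make the pieces available up to null sets. The Radon--Nikodym
  theorem supplies pieces \<open>A\<close> on which \<open>h \<mapsto> h \<circ> \<phi>\<close> is bounded from \<open>L\<^sub>2 \<mu>1\<close> to \<open>L\<^sub>2 \<mu>\<close>
  (\<open>exhausted_dominated\<close>). Standard Borel spaces supply the sections: the graph of \<open>\<phi>\<close> becomes a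
  Borel set in a Polish space, and over a compact subset of the graph a section is found by taking
  the lexicographic minimum of each fibre (\<open>exhaustion_by_sections\<close>).

  The other inclusion, \<open>\<Phi>\<^sub>0 K \<subseteq> \<Phi> K\<close>, holds for every \<open>K\<close>, because a rapidly convergent
  sequence in \<open>\<Gamma>\<close> converges m.a.e. (\<open>Phi0_subset_Phi\<close>).
\<close>

section \<open>Properties that hold marginally almost everywhere\<close>

lemma mae_iff:
  "mae M N P \<longleftrightarrow>
     (\<exists>A \<in> null_sets M. \<exists>B \<in> null_sets N. \<forall>x \<in> space M - A. \<forall>y \<in> space N - B. P (x, y))"
proof -
  have "{p \<in> space M \<times> space N. \<not> P p} \<subseteq> A \<times> space N \<union> space M \<times> B \<longleftrightarrow>
      (\<forall>x \<in> space M - A. \<forall>y \<in> space N - B. P (x, y))" for A B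
    by auto
  moreover have "{p \<in> space M \<times> space N. \<not> P p} \<subseteq> space M \<times> space N" by auto
  ultimately show ?thesis unfolding mae_def marginally_null_def by simp
qed

lemma mae_mono: "mae M N P \<Longrightarrow> (\<And>p. p \<in> space M \<times> space N \<Longrightarrow> P p \<Longrightarrow> Q p) \<Longrightarrow> mae M N Q"
  unfolding mae_iff by (elim bexE, intro bexI) auto

lemma mae_all:
  assumes "\<And>n::nat. mae M N (P n)"
  shows "mae M N (\<lambda>p. \<forall>n. P n p)"
proof -
  have "\<forall>n. \<exists>AB. fst AB \<in> null_sets M \<and> snd AB \<in> null_sets N \<and>
      (\<forall>x \<in> space M - fst AB. \<forall>y \<in> space N - snd AB. P n (x, y))"
  proof
    fix n
    obtain A B where "A \<in> null_sets M" "B \<in> null_sets N"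
      "\<forall>x \<in> space M - A. \<forall>y \<in> space N - B. P n (x, y)"
      using assms[of n] unfolding mae_iff by blast
    then show "\<exists>AB. fst AB \<in> null_sets M \<and> snd AB \<in> null_sets N \<and>
      (\<forall>x \<in> space M - fst AB. \<forall>y \<in> space N - snd AB. P n (x, y))"
      by (intro exI[of _ "(A, B)"]) simp
  qed
  from choice[OF this] obtain C where C: "\<And>n. fst (C n) \<in> null_sets M" "\<And>n. snd (C n) \<in> null_sets N"
    "\<And>n x y. x \<in> space M - fst (C n) \<Longrightarrow> y \<in> space N - snd (C n) \<Longrightarrow> P n (x, y)" by blast
  show ?thesis
    unfolding mae_iff
  proof (intro bexI ballI allI)
    show "(\<Union>n. fst (C n)) \<in> null_sets M" "(\<Union>n. snd (C n)) \<in> null_sets N"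
      using C by (auto intro: null_sets_UN)
  qed (use C(3) in blast)
qed

lemma mae_conj: 
  assumes "mae M N P" "mae M N Q"
  shows "mae M N (\<lambda>p. P p \<and> Q p)"
proof -
  have "mae M N (\<lambda>p. \<forall>n. (if n = (0::nat) then P else Q) p)"
    by (rule mae_all) (use assms in auto)
  then show ?thesis by (rule mae_mono) (metis zero_neq_one)
qed

lemma mae_fst: "AE x in M. P x \<Longrightarrow> mae M N (\<lambda>p. P (fst p))"
  unfolding mae_iff by (auto elim!: AE_E3 intro: bexI[of _ "{}"])

lemma mae_snd: "AE y in N. P y \<Longrightarrow> mae M N (\<lambda>p. P (snd p))"
  unfolding mae_iff by (auto elim!: AE_E3 intro: bexI[of _ "{}"])

lemma mae_True: "(\<And>p. p \<in> space M \<times> space N \<Longrightarrow> P p) \<Longrightarrow> mae M N P"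
  unfolding mae_iff by (auto intro!: bexI[of _ "{}"])


section \<open>Square sums and the norm of the projective tensor product\<close>

text \<open>The squared \<open>\<ell>\<^sup>2\<close> norm. Values in \<open>ennreal\<close> make sense without any summability.\<close>

definition sqsum :: "(nat \<Rightarrow> complex) \<Rightarrow> ennreal" where
  "sqsum h = (\<Sum>n. ennreal ((cmod (h n))\<^sup>2))"

text \<open>The squared norm of a sequence of functions, regarded as one \<open>\<ell>\<^sup>2\<close>-valued function in \<open>L\<^sub>2\<close>.\<close>

definition energy :: "'a measure \<Rightarrow> (nat \<Rightarrow> 'a \<Rightarrow> complex) \<Rightarrow> ennreal" where
  "energy M h = (\<integral>\<^sup>+x. sqsum (\<lambda>n. h n x) \<partial>M)"

lemma sqsum_measurable [measurable]:
  "(\<And>n. h n \<in> borel_measurable M) \<Longrightarrow> (\<lambda>x. sqsum (\<lambda>n. h n x)) \<in> borel_measurable M"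
  unfolding sqsum_def by measurable

lemma energy_eq_suminf:
  "(\<And>n. h n \<in> borel_measurable M) \<Longrightarrow>
     energy M h = (\<Sum>n. \<integral>\<^sup>+x. ennreal ((cmod (h n x))\<^sup>2) \<partial>M)"
  unfolding energy_def sqsum_def by (rule nn_integral_suminf) measurable

lemma energy_L2:
  assumes "f \<in> L2 M"
  shows "(\<integral>\<^sup>+x. ennreal ((cmod (f x))\<^sup>2) \<partial>M) = ennreal ((L2_norm M f)\<^sup>2)"
  using assms unfolding L2_def L2_norm_def
  by (subst nn_integral_eq_integral) (auto intro!: integral_nonneg_AE)

lemma L2_iff:
  "f \<in> L2 M \<longleftrightarrow> f \<in> borel_measurable M \<and> (\<integral>\<^sup>+x. ennreal ((cmod (f x))\<^sup>2) \<partial>M) < \<infinity>"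
  unfolding L2_def by (auto simp: integrable_iff_bounded)

lemma L2_norm_nonneg: "L2_norm M f \<ge> 0"
  unfolding L2_norm_def by (simp add: integral_nonneg_AE)

lemma L2_norm_eq_0D:
  assumes "f \<in> L2 M" "L2_norm M f = 0"
  shows "AE x in M. f x = 0"
proof -
  have [measurable]: "f \<in> borel_measurable M" using assms(1) by (simp add: L2_def)
  have "(\<integral>\<^sup>+x. ennreal ((cmod (f x))\<^sup>2) \<partial>M) = 0" using energy_L2[OF assms(1)] assms(2) by simp
  then show ?thesis by (subst (asm) nn_integral_0_iff_AE) auto
qed

lemma L2_scale: "f \<in> L2 M \<Longrightarrow> (\<lambda>x. complex_of_real t * f x) \<in> L2 M"
  unfolding L2_def by (auto simp: norm_mult power_mult_distrib)

lemma L2_norm_scale: "t \<ge> 0 \<Longrightarrow> L2_norm M (\<lambda>x. complex_of_real t * f x) = t * L2_norm M f"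
  unfolding L2_norm_def by (simp add: norm_mult power_mult_distrib real_sqrt_mult)

text \<open>A representation of \<open>H\<close> as the pairing of two \<open>\<ell>\<^sup>2\<close>-valued functions, with the weight
  distributed evenly: \<open>c\<close> bounds both energies, so that the \<open>\<Gamma>\<close>-norm is below \<open>c\<close> as well.\<close>

definition balanced_rep ::
    "'a measure \<Rightarrow> 'b measure \<Rightarrow> ennreal \<Rightarrow> ('a \<times> 'b \<Rightarrow> complex) \<Rightarrow>
     (nat \<Rightarrow> 'a \<Rightarrow> complex) \<Rightarrow> (nat \<Rightarrow> 'b \<Rightarrow> complex) \<Rightarrow> bool" where
  "balanced_rep M N c H h k \<longleftrightarrow>
     (\<forall>n. h n \<in> borel_measurable M \<and> k n \<in> borel_measurable N) \<and>
     energy M h < c \<and> energy N k < c \<and>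
     mae M N (\<lambda>(x, y). (\<lambda>n. h n x * k n y) sums H (x, y))"

lemma energy_less_imp_L2:
  assumes m: "\<And>n. h n \<in> borel_measurable M" and c: "energy M h < ennreal c"
  shows "h n \<in> L2 M" "summable (\<lambda>n. (L2_norm M (h n))\<^sup>2)" "(\<Sum>n. (L2_norm M (h n))\<^sup>2) < c"
proof -
  let ?I = "\<lambda>n. \<integral>\<^sup>+x. ennreal ((cmod (h n x))\<^sup>2) \<partial>M"
  have E: "energy M h = (\<Sum>n. ?I n)" by (rule energy_eq_suminf[OF m])
  have fin: "energy M h < \<infinity>" using c by (metis ennreal_less_top infinity_ennreal_def order.strict_trans)
  have L2: "h n \<in> L2 M" for n
  proof -
    have "?I n \<le> (\<Sum>n. ?I n)"
      using sum_le_suminf[of ?I "{n}"] by simp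
    then show ?thesis using fin m E unfolding L2_iff by auto
  qed
  then show "h n \<in> L2 M" .
  have E': "energy M h = (\<Sum>n. ennreal ((L2_norm M (h n))\<^sup>2))"
    unfolding E by (simp add: energy_L2[OF L2])
  show sm: "summable (\<lambda>n. (L2_norm M (h n))\<^sup>2)"
    by (rule summable_suminf_not_top) (use fin E' in auto)
  have "energy M h = ennreal (\<Sum>n. (L2_norm M (h n))\<^sup>2)"
    unfolding E' by (rule suminf_ennreal2) (use sm in auto)
  then show "(\<Sum>n. (L2_norm M (h n))\<^sup>2) < c"
    using c by (simp add: ennreal_less_iff suminf_nonneg sm)
qed

text \<open>Given a representation with \<open>\<Sum>\<parallel>f n\<parallel>\<parallel>g n\<parallel> < c\<close>, scaling \<open>f n\<close> and \<open>g n\<close> reciprocally makes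
  both squared norms equal to \<open>\<parallel>f n\<parallel>\<parallel>g n\<parallel>\<close>; terms with a factor of norm zero vanish m.a.e. and are
  dropped. Conversely \<open>ab \<le> (a\<^sup>2 + b\<^sup>2) / 2\<close> turns bounds on the energies into a bound on the norm.\<close>

lemma Gamma_norm_less_iff:
  "H \<in> Gamma_space M N \<and> Gamma_norm M N H < c \<longleftrightarrow> (\<exists>h k. balanced_rep M N (ennreal c) H h k)"
proof
  assume "H \<in> Gamma_space M N \<and> Gamma_norm M N H < c"
  then obtain f g where fg: "Gamma_rep M N H f g"
    and less: "(\<Sum>n. L2_norm M (f n) * L2_norm N (g n)) < c"
    unfolding Gamma_space_def Gamma_norm_def by (auto dest!: cInf_lessD[rotated])
  let ?a = "\<lambda>n. L2_norm M (f n)" and ?b = "\<lambda>n. L2_norm N (g n)"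
  have f: "f n \<in> L2 M" and g: "g n \<in> L2 N" for n using fg by (auto simp: Gamma_rep_def)
  have sm: "summable (\<lambda>n. ?a n * ?b n)" using fg by (simp add: Gamma_rep_def)
  define z where "z n \<longleftrightarrow> ?a n = 0 \<or> ?b n = 0" for n
  define t where "t n = (if z n then 0 else sqrt (?b n / ?a n))" for n
  \<comment> \<open>on the terms with \<open>z n\<close> the factor \<open>t n\<close>, and with it \<open>1 / t n\<close>, is zero\<close>
  define h where "h n x = complex_of_real (t n) * f n x" for n x
  define k where "k n y = complex_of_real (1 / t n) * g n y" for n y
  have a: "?a n \<ge> 0" and b: "?b n \<ge> 0" for n by (simp_all add: L2_norm_nonneg)
  have t: "t n \<ge> 0" for n using a b by (simp add: t_def)
  have hL: "h n \<in> L2 M" and kL: "k n \<in> L2 N" for n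
    unfolding h_def[abs_def] k_def[abs_def] by (intro L2_scale f g)+
  have t2: "(t n)\<^sup>2 = ?b n / ?a n" if "\<not> z n" for n
    using that a[of n] b[of n] by (simp add: t_def)
  have hn: "(L2_norm M (h n))\<^sup>2 = ?a n * ?b n" for n
  proof (cases "z n")
    case True
    then show ?thesis
      unfolding h_def[abs_def] L2_norm_scale[OF t] by (auto simp: t_def z_def)
  next
    case False
    then show ?thesis
      unfolding h_def[abs_def] L2_norm_scale[OF t] power_mult_distrib t2[OF False]
      by (simp add: z_def power2_eq_square)
  qed
  have kn: "(L2_norm N (k n))\<^sup>2 = ?a n * ?b n" for n
  proof -
    have "L2_norm N (k n) = (1 / t n) * ?b n"
      unfolding k_def[abs_def] using t by (intro L2_norm_scale) simp
    then have "(L2_norm N (k n))\<^sup>2 = (?b n)\<^sup>2 / (t n)\<^sup>2" by (simp add: power_divide)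
    then show ?thesis using t2[of n] by (cases "z n") (auto simp: t_def z_def power2_eq_square)
  qed
  have c0: "c > 0" using less suminf_nonneg[OF sm] a b by (meson le_less_trans mult_nonneg_nonneg)
  have en: "energy Q r < ennreal c" if "\<And>n. r n \<in> L2 Q" "\<And>n. (L2_norm Q (r n))\<^sup>2 = ?a n * ?b n"
    for Q :: "'z measure" and r
  proof -
    have m: "r n \<in> borel_measurable Q" for n using that(1) by (simp add: L2_def)
    have "energy Q r = (\<Sum>n. ennreal (?a n * ?b n))"
      unfolding energy_eq_suminf[OF m] by (simp add: energy_L2 that)
    also have "\<dots> = ennreal (\<Sum>n. ?a n * ?b n)"
      using a b sm by (intro suminf_ennreal2) auto
    also have "\<dots> < ennreal c" using less c0 by (simp add: ennreal_lessI)
    finally show ?thesis .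
  qed
  have eq: "mae M N (\<lambda>p. \<forall>n. h n (fst p) * k n (snd p) = f n (fst p) * g n (snd p))"
  proof (rule mae_all)
    fix n
    show "mae M N (\<lambda>p. h n (fst p) * k n (snd p) = f n (fst p) * g n (snd p))"
    proof (cases "z n")
      case False
      then have "t n \<noteq> 0" by (simp add: t_def z_def)
      then show ?thesis by (intro mae_True) (simp add: h_def k_def)
    next
      case True
      then have h0: "h n x = 0" for x by (simp add: h_def t_def)
      from True consider "?a n = 0" | "?b n = 0" unfolding z_def by blast
      then show ?thesis
      proof cases
        case 1
        from mae_fst[OF L2_norm_eq_0D[OF f 1]] show ?thesis by (rule mae_mono) (simp add: h0)
      next
        case 2
        from mae_snd[OF L2_norm_eq_0D[OF g 2]] show ?thesis by (rule mae_mono) (simp add: h0)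
      qed
    qed
  qed
  have "mae M N (\<lambda>(x, y). (\<lambda>n. f n x * g n y) sums H (x, y))" using fg by (simp add: Gamma_rep_def)
  from mae_conj[OF this eq] have "mae M N (\<lambda>(x, y). (\<lambda>n. h n x * k n y) sums H (x, y))"
    by (rule mae_mono) auto
  then have "balanced_rep M N (ennreal c) H h k"
    unfolding balanced_rep_def using hL kL en[OF hL hn] en[OF kL kn] by (auto simp: L2_def)
  then show "\<exists>h k. balanced_rep M N (ennreal c) H h k" by blast
next
  assume "\<exists>h k. balanced_rep M N (ennreal c) H h k"
  then obtain h k where r: "balanced_rep M N (ennreal c) H h k" by blast
  let ?a = "\<lambda>n. L2_norm M (h n)" and ?b = "\<lambda>n. L2_norm N (k n)"
  have a: "\<And>n. h n \<in> L2 M" "summable (\<lambda>n. (?a n)\<^sup>2)" "(\<Sum>n. (?a n)\<^sup>2) < c"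
    using r by (auto simp: balanced_rep_def intro!: energy_less_imp_L2)
  have b: "\<And>n. k n \<in> L2 N" "summable (\<lambda>n. (?b n)\<^sup>2)" "(\<Sum>n. (?b n)\<^sup>2) < c"
    using r by (auto simp: balanced_rep_def intro!: energy_less_imp_L2)
  have le: "?a n * ?b n \<le> ((?a n)\<^sup>2 + (?b n)\<^sup>2) / 2" for n
    using sum_squares_bound[of "?a n" "?b n"] by simp
  have sab: "summable (\<lambda>n. ((?a n)\<^sup>2 + (?b n)\<^sup>2) / 2)"
    by (intro summable_divide summable_add a b)
  have nn: "?a n * ?b n \<ge> 0" for n by (simp add: L2_norm_nonneg)
  have sm: "summable (\<lambda>n. ?a n * ?b n)"
    by (rule summable_comparison_test'[OF sab, of 0]) (use le nn in auto)
  have "(\<Sum>n. ?a n * ?b n) \<le> (\<Sum>n. ((?a n)\<^sup>2 + (?b n)\<^sup>2) / 2)"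
    by (rule suminf_le[OF le sm sab])
  also have "\<dots> = ((\<Sum>n. (?a n)\<^sup>2) + (\<Sum>n. (?b n)\<^sup>2)) / 2"
    by (simp add: suminf_add a b suminf_divide summable_add)
  also have "\<dots> < c" using a b by simp
  finally have less: "(\<Sum>n. ?a n * ?b n) < c" .
  have rep: "Gamma_rep M N H h k"
    using r a(1) b(1) sm by (simp add: Gamma_rep_def balanced_rep_def)
  have "Gamma_norm M N H \<le> (\<Sum>n. ?a n * ?b n)"
    unfolding Gamma_norm_def
  proof (rule cInf_lower)
    show "bdd_below {\<Sum>n. L2_norm M (f n) * L2_norm N (g n) |f g. Gamma_rep M N H f g}"
      by (rule bdd_belowI[of _ 0]) (auto simp: Gamma_rep_def L2_norm_nonneg intro!: suminf_nonneg)
  qed (use rep in blast)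
  then show "H \<in> Gamma_space M N \<and> Gamma_norm M N H < c"
    using rep less by (auto simp: Gamma_space_def)
qed

lemma sqsum_scale: "sqsum (\<lambda>n. c * a n) = ennreal ((cmod c)\<^sup>2) * sqsum a"
  unfolding sqsum_def
  by (simp add: norm_mult power_mult_distrib ennreal_mult ennreal_suminf_cmult)

lemma sqsum_uminus: "sqsum (\<lambda>n. - a n) = sqsum a"
  by (simp add: sqsum_def)

lemma sqsum_add_le: "sqsum (\<lambda>n. a n + b n) \<le> 2 * sqsum a + 2 * sqsum b"
proof -
  have "(cmod (a n + b n))\<^sup>2 \<le> 2 * (cmod (a n))\<^sup>2 + 2 * (cmod (b n))\<^sup>2" for n
  proof -
    have "(cmod (a n + b n))\<^sup>2 \<le> (cmod (a n) + cmod (b n))\<^sup>2"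
      by (intro power_mono norm_triangle_ineq) simp
    also have "\<dots> \<le> 2 * (cmod (a n))\<^sup>2 + 2 * (cmod (b n))\<^sup>2"
      using sum_squares_bound[of "cmod (a n)" "cmod (b n)"] by (simp add: power2_sum)
    finally show ?thesis .
  qed
  then have "ennreal ((cmod (a n + b n))\<^sup>2) \<le> 2 * ennreal ((cmod (a n))\<^sup>2) + 2 * ennreal ((cmod (b n))\<^sup>2)" for n
    by (subst ennreal_numeral[symmetric])+ (auto simp flip: ennreal_mult ennreal_plus simp del: ennreal_numeral)
  then have "sqsum (\<lambda>n. a n + b n) \<le> (\<Sum>n. 2 * ennreal ((cmod (a n))\<^sup>2) + 2 * ennreal ((cmod (b n))\<^sup>2))"
    unfolding sqsum_def by (intro suminf_le) auto
  also have "\<dots> = 2 * sqsum a + 2 * sqsum b"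
    unfolding sqsum_def by (simp add: suminf_add[symmetric] ennreal_suminf_cmult)
  finally show ?thesis .
qed

lemma sqsum_diff_le: "sqsum (\<lambda>n. a n - b n) \<le> 2 * sqsum a + 2 * sqsum b"
  using sqsum_add_le[of a "\<lambda>n. - b n"] by (simp add: sqsum_uminus)

lemma sum_le_sqsum: "(\<Sum>i<n. ennreal ((cmod (a i))\<^sup>2)) \<le> sqsum a"
  unfolding sqsum_def by (intro sum_le_suminf) auto

lemma mult_le_sum_squares: "x * y \<le> x\<^sup>2 + (y\<^sup>2 :: real)"
proof -
  have "2 * (x * y) \<le> x\<^sup>2 + y\<^sup>2" using sum_squares_bound[of x y] by (simp add: mult.assoc)
  moreover have "0 \<le> x\<^sup>2 + y\<^sup>2" by simp
  ultimately show ?thesis by linarith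
qed

lemma cmod_sums_le_sqsum:
  assumes "(\<lambda>n. a n * b n) sums s"
  shows "ennreal (cmod s) \<le> sqsum a + sqsum b"
proof (rule LIMSEQ_le_const2)
  show "(\<lambda>n. ennreal (cmod (\<Sum>i<n. a i * b i))) \<longlonglongrightarrow> ennreal (cmod s)"
    using assms by (auto simp: sums_def intro!: tendsto_ennrealI tendsto_norm)
  have "ennreal (cmod (\<Sum>i<n. a i * b i)) \<le> sqsum a + sqsum b" for n
  proof -
    have "cmod (\<Sum>i<n. a i * b i) \<le> (\<Sum>i<n. (cmod (a i))\<^sup>2 + (cmod (b i))\<^sup>2)"
    proof (rule sum_norm_le)
      fix i
      show "cmod (a i * b i) \<le> (cmod (a i))\<^sup>2 + (cmod (b i))\<^sup>2"
        unfolding norm_mult by (rule mult_le_sum_squares)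
    qed
    then have "ennreal (cmod (\<Sum>i<n. a i * b i)) \<le> ennreal (\<Sum>i<n. (cmod (a i))\<^sup>2 + (cmod (b i))\<^sup>2)"
      by (rule ennreal_leI)
    also have "\<dots> = (\<Sum>i<n. ennreal ((cmod (a i))\<^sup>2)) + (\<Sum>i<n. ennreal ((cmod (b i))\<^sup>2))"
      by (simp add: sum.distrib sum_nonneg)
    also have "\<dots> \<le> sqsum a + sqsum b" by (intro add_mono sum_le_sqsum)
    finally show ?thesis .
  qed
  then show "\<exists>N. \<forall>n\<ge>N. ennreal (cmod (\<Sum>i<n. a i * b i)) \<le> sqsum a + sqsum b" by blast
qed

lemma sqsum_summable: "sqsum a < \<infinity> \<Longrightarrow> summable (\<lambda>n. (cmod (a n))\<^sup>2)"
  unfolding sqsum_def by (rule summable_suminf_not_top) auto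

lemma summable_mult_sqsum:
  assumes "sqsum a < \<infinity>" "sqsum b < \<infinity>"
  shows "summable (\<lambda>n. a n * b n)"
proof (rule summable_comparison_test')
  show "summable (\<lambda>n. (cmod (a n))\<^sup>2 + (cmod (b n))\<^sup>2)"
    by (intro summable_add sqsum_summable assms)
  fix n
  show "norm (a n * b n) \<le> (cmod (a n))\<^sup>2 + (cmod (b n))\<^sup>2"
    unfolding norm_mult by (rule mult_le_sum_squares)
qed

text \<open>Merging the terms of two representations gives a representation of the sum.\<close>

definition interleave :: "(nat \<Rightarrow> 'a) \<Rightarrow> (nat \<Rightarrow> 'a) \<Rightarrow> nat \<Rightarrow> 'a" where
  "interleave a b n = (if even n then a (n div 2) else b (n div 2))"

lemma sums_interleave:
  fixes a b :: "nat \<Rightarrow> complex"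
  assumes "a sums s" "b sums t"
  shows "interleave a b sums (s + t)"
proof -
  have *: "(\<lambda>n. interleave a b n) sums (x + y)" if "b sums x" "a sums y" for a b :: "nat \<Rightarrow> real" and x y
  proof -
    have "(\<lambda>n. interleave a b n) = (\<lambda>n. if even n then a (n div 2) else b ((n - 1) div 2))"
      by (auto simp: interleave_def fun_eq_iff elim!: oddE)
    then show ?thesis using sums_if[OF that] by simp
  qed
  have "(\<lambda>n. Re (interleave a b n)) = interleave (\<lambda>n. Re (a n)) (\<lambda>n. Re (b n))"
    "(\<lambda>n. Im (interleave a b n)) = interleave (\<lambda>n. Im (a n)) (\<lambda>n. Im (b n))"
    by (auto simp: interleave_def fun_eq_iff)
  then show ?thesis
    using assms *[of "\<lambda>n. Re (b n)" "Re t" "\<lambda>n. Re (a n)" "Re s"]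
      *[of "\<lambda>n. Im (b n)" "Im t" "\<lambda>n. Im (a n)" "Im s"]
    by (simp add: sums_complex_iff add.commute)
qed

lemma sqsum_interleave: "sqsum (interleave a b) \<le> sqsum a + sqsum b"
  unfolding sqsum_def[of "interleave a b"]
proof (rule suminf_le_const)
  fix n
  have *: "(\<Sum>i<2*n. ennreal ((cmod (interleave a b i))\<^sup>2))
      = (\<Sum>i<n. ennreal ((cmod (a i))\<^sup>2)) + (\<Sum>i<n. ennreal ((cmod (b i))\<^sup>2))"
    by (induction n) (auto simp: interleave_def algebra_simps)
  have "(\<Sum>i<n. ennreal ((cmod (interleave a b i))\<^sup>2)) \<le> (\<Sum>i<2*n. ennreal ((cmod (interleave a b i))\<^sup>2))"
    by (rule sum_mono2) auto
  also have "\<dots> \<le> sqsum a + sqsum b" unfolding * by (intro add_mono sum_le_sqsum)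
  finally show "(\<Sum>i<n. ennreal ((cmod (interleave a b i))\<^sup>2)) \<le> sqsum a + sqsum b" .
qed auto

text \<open>Says that \<open>H\<close> belongs to \<open>\<Gamma>\<close> and has norm less than \<open>c\<close>. Membership has to be included, since
  \<open>Gamma_norm\<close> has no meaning outside \<open>\<Gamma>\<close>, where it is the infimum of the empty set.\<close>

definition Gamma_below ::
    "'a measure \<Rightarrow> 'b measure \<Rightarrow> real \<Rightarrow> ('a \<times> 'b \<Rightarrow> complex) \<Rightarrow> bool" where
  "Gamma_below M N c H \<longleftrightarrow> (\<exists>h k. balanced_rep M N (ennreal c) H h k)"

lemma balanced_rep_pos:
  assumes "balanced_rep M N (ennreal c) H h k"
  shows "c > 0"
proof -
  have "energy M h < ennreal c" using assms by (simp add: balanced_rep_def)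
  then have "0 < ennreal c" by (rule le_less_trans[OF zero_le])
  then show ?thesis by simp
qed

lemma Gamma_below_iff: "Gamma_below M N c H \<longleftrightarrow> H \<in> Gamma_space M N \<and> Gamma_norm M N H < c"
  by (simp add: Gamma_below_def Gamma_norm_less_iff)

lemma Gamma_space_iff: "H \<in> Gamma_space M N \<longleftrightarrow> (\<exists>c. Gamma_below M N c H)"
  unfolding Gamma_below_iff using lt_ex gt_ex by blast

lemma Gamma_below_add:
  assumes "Gamma_below M N c F" "Gamma_below M N d G"
  shows "Gamma_below M N (c + d) (\<lambda>p. F p + G p)"
proof -
  obtain h k where r: "balanced_rep M N (ennreal c) F h k" using assms(1) by (auto simp: Gamma_below_def)
  obtain h' k' where r': "balanced_rep M N (ennreal d) G h' k'" using assms(2) by (auto simp: Gamma_below_def)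
  have pos: "c > 0" "d > 0" using balanced_rep_pos[OF r] balanced_rep_pos[OF r'] by auto
  have en: "energy Q (interleave a b) < ennreal (c + d)"
    if "\<And>n. a n \<in> borel_measurable Q" "\<And>n. b n \<in> borel_measurable Q" "energy Q a < ennreal c" "energy Q b < ennreal d"
    for Q :: "'z measure" and a b
  proof -
    have "energy Q (interleave a b) \<le> (\<integral>\<^sup>+x. sqsum (\<lambda>n. a n x) + sqsum (\<lambda>n. b n x) \<partial>Q)"
      unfolding energy_def
    proof (rule nn_integral_mono)
      fix x
      have "(\<lambda>n. interleave a b n x) = interleave (\<lambda>n. a n x) (\<lambda>n. b n x)"
        by (auto simp: interleave_def)
      then show "sqsum (\<lambda>n. interleave a b n x) \<le> sqsum (\<lambda>n. a n x) + sqsum (\<lambda>n. b n x)"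
        by (simp add: sqsum_interleave)
    qed
    also have "\<dots> = energy Q a + energy Q b"
      unfolding energy_def by (intro nn_integral_add sqsum_measurable that)
    also have "\<dots> < ennreal c + ennreal d" using that(3,4) by (rule add_strict_mono)
    finally show ?thesis using pos by simp
  qed
  have m: "interleave a b n \<in> borel_measurable Q" 
    if "\<And>n. a n \<in> borel_measurable Q" "\<And>n. b n \<in> borel_measurable Q" for Q :: "'z measure" and a b :: "nat \<Rightarrow> 'z \<Rightarrow> complex" and n
    using that by (simp add: interleave_def)
  have "mae M N (\<lambda>(x, y). (\<lambda>n. interleave h h' n x * interleave k k' n y) sums (F (x, y) + G (x, y)))"
  proof (rule mae_mono[OF mae_conj])
    show "mae M N (\<lambda>(x, y). (\<lambda>n. h n x * k n y) sums F (x, y))"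
      "mae M N (\<lambda>(x, y). (\<lambda>n. h' n x * k' n y) sums G (x, y))"
      using r r' by (simp_all add: balanced_rep_def)
    fix p assume a: "(case p of (x, y) \<Rightarrow> (\<lambda>n. h n x * k n y) sums F (x, y)) \<and>
      (case p of (x, y) \<Rightarrow> (\<lambda>n. h' n x * k' n y) sums G (x, y))"
    obtain x y where p: "p = (x, y)" by force
    have "(\<lambda>n. interleave h h' n x * interleave k k' n y) = interleave (\<lambda>n. h n x * k n y) (\<lambda>n. h' n x * k' n y)"
      by (auto simp: interleave_def)
    then show "case p of (x, y) \<Rightarrow> (\<lambda>n. interleave h h' n x * interleave k k' n y) sums (F (x, y) + G (x, y))"
      using a p by (simp add: sums_interleave)
  qed
  then have "balanced_rep M N (ennreal (c + d)) (\<lambda>p. F p + G p) (interleave h h') (interleave k k')"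
    using r r' unfolding balanced_rep_def by (auto intro!: en m)
  then show ?thesis unfolding Gamma_below_def by blast
qed

lemma Gamma_below_uminus:
  assumes "Gamma_below M N c F"
  shows "Gamma_below M N c (\<lambda>p. - F p)"
proof -
  obtain h k where r: "balanced_rep M N (ennreal c) F h k" using assms(1) by (auto simp: Gamma_below_def)
  have "mae M N (\<lambda>(x, y). (\<lambda>n. h n x * k n y) sums F (x, y))" using r by (simp add: balanced_rep_def)
  then have "mae M N (\<lambda>(x, y). (\<lambda>n. - h n x * k n y) sums (- F (x, y)))"
    by (rule mae_mono) (auto dest: sums_minus)
  then have "balanced_rep M N (ennreal c) (\<lambda>p. - F p) (\<lambda>n x. - h n x) k"
    using r unfolding balanced_rep_def by (auto simp: energy_def sqsum_uminus)
  then show ?thesis unfolding Gamma_below_def by blast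
qed

lemma Gamma_space_add: "F \<in> Gamma_space M N \<Longrightarrow> G \<in> Gamma_space M N \<Longrightarrow> (\<lambda>p. F p + G p) \<in> Gamma_space M N"
  unfolding Gamma_space_iff using Gamma_below_add by blast

lemma Gamma_space_diff: "F \<in> Gamma_space M N \<Longrightarrow> G \<in> Gamma_space M N \<Longrightarrow> (\<lambda>p. F p - G p) \<in> Gamma_space M N"
  unfolding Gamma_space_iff using Gamma_below_add[of M N _ F _ "\<lambda>p. - G p"] Gamma_below_uminus by fastforce

lemma Gamma_below_zero: "c > 0 \<Longrightarrow> Gamma_below M N c (\<lambda>_. 0)"
  unfolding Gamma_below_def balanced_rep_def
  by (intro exI[of _ "\<lambda>_ _. 0"]) (auto simp: energy_def sqsum_def intro!: mae_True)

text \<open>The norm of \<open>\<Gamma>\<close> is bounded by the geometric mean of the energies: scaling the two factors by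
  \<open>sqrt t\<close> and \<open>1 / sqrt t\<close> changes the energies \<open>\<alpha>\<close> and \<open>\<beta>\<close> into \<open>t * \<alpha>\<close> and \<open>\<beta> / t\<close>, which are
  both below \<open>c\<close> for a suitable \<open>t\<close>. One small energy therefore outweighs one that is only
  bounded.\<close>

lemma Gamma_below_of_energies:
  assumes m: "\<And>n. h n \<in> borel_measurable M" "\<And>n. k n \<in> borel_measurable N"
    and e: "energy M h \<le> ennreal \<alpha>" "energy N k \<le> ennreal \<beta>" "\<alpha> \<ge> 0" "\<beta> \<ge> 0"
    and c: "\<alpha> * \<beta> < c\<^sup>2" "c > 0"
    and H: "mae M N (\<lambda>(x, y). (\<lambda>n. h n x * k n y) sums H (x, y))"
  shows "Gamma_below M N c H"
proof -
  obtain t where t: "t > 0" "t * \<alpha> < c" "\<beta> / t < c"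
  proof (cases "\<alpha> = 0")
    case True
    have "\<beta> / c + 1 > 0" using e c by (simp add: add_nonneg_pos)
    then show thesis using c e by (intro that[of "\<beta> / c + 1"]) (auto simp: True field_simps)
  next
    case False
    then have "\<alpha> > 0" using e by simp
    then have "\<beta> / c < c / \<alpha>" using c by (simp add: field_simps power2_eq_square)
    then obtain t where "\<beta> / c < t" "t < c / \<alpha>" using dense by blast
    moreover have "\<beta> / c \<ge> 0" using e c by simp
    ultimately have "t > 0" "t * \<alpha> < c" "\<beta> < t * c"
      using c \<open>\<alpha> > 0\<close> by (linarith, auto simp: field_simps)
    then show thesis by (intro that[of t]) (auto simp: field_simps)
  qed
  have en: "energy Q (\<lambda>n x. complex_of_real s * a n x) < ennreal c"
    if "\<And>n. a n \<in> borel_measurable Q" "energy Q a \<le> ennreal \<gamma>" "\<gamma> \<ge> 0" "s\<^sup>2 * \<gamma> < c"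
    for Q :: "'z measure" and a \<gamma> s
  proof -
    have "energy Q (\<lambda>n x. complex_of_real s * a n x) = ennreal (s\<^sup>2) * energy Q a"
      unfolding energy_def sqsum_scale using that(1) by (subst nn_integral_cmult) simp_all
    also have "\<dots> \<le> ennreal (s\<^sup>2) * ennreal \<gamma>" using that by (intro mult_left_mono) auto
    also have "\<dots> = ennreal (s\<^sup>2 * \<gamma>)" using that by (simp add: ennreal_mult)
    also have "\<dots> < ennreal c" using that c by (intro ennreal_lessI) auto
    finally show ?thesis .
  qed
  have "balanced_rep M N (ennreal c) H (\<lambda>n x. complex_of_real (sqrt t) * h n x) (\<lambda>n y. complex_of_real (1 / sqrt t) * k n y)"
    unfolding balanced_rep_def
  proof (intro conjI allI)
    show "energy M (\<lambda>n x. complex_of_real (sqrt t) * h n x) < ennreal c"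
      by (rule en[OF m(1) e(1,3)]) (use t in auto)
    show "energy N (\<lambda>n x. complex_of_real (1 / sqrt t) * k n x) < ennreal c"
      by (rule en[OF m(2) e(2,4)]) (use t in \<open>auto simp: power_divide\<close>)
    show "mae M N (\<lambda>(x, y). (\<lambda>n. complex_of_real (sqrt t) * h n x * (complex_of_real (1 / sqrt t) * k n y)) sums H (x, y))"
    proof -
      have "complex_of_real (sqrt t) * a * (complex_of_real (1 / sqrt t) * b) = a * b" for a b
        using t by simp
      then show ?thesis using H by simp
    qed
  qed (use m in auto)
  then show ?thesis unfolding Gamma_below_def by blast
qed


section \<open>The closed subspace of functions vanishing near a set\<close>

lemma Phi0_iff:
  "F \<in> Phi0 M N K \<longleftrightarrow> F \<in> Gamma_space M N \<and>
     (\<forall>e>0. \<exists>G \<in> Gamma_space M N. (\<exists>U. pseudo_open M N U \<and> K \<subseteq> U \<and> vanishes_on M N G U) \<and>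
        Gamma_below M N e (\<lambda>p. F p - G p))"
proof -
  have "Gamma_norm M N (\<lambda>p. F p - G p) < e \<longleftrightarrow> Gamma_below M N e (\<lambda>p. F p - G p)"
    if "F \<in> Gamma_space M N" "G \<in> Gamma_space M N" for G e
    using Gamma_space_diff[OF that] by (simp add: Gamma_below_iff)
  note eq = this
  show ?thesis
    unfolding Phi0_def Gamma_closure_def mem_Collect_eq
    by (rule conj_cong[OF refl]) (simp add: eq Bex_def conj_assoc cong: conj_cong)
qed

text \<open>This makes the functions vanishing near a set a linear subspace: the sum of two of them vanishes
  on the intersection of the two neighbourhoods.\<close>

lemma pseudo_open_Int:
  assumes "pseudo_open M N U" "pseudo_open M N V"
  shows "pseudo_open M N (U \<inter> V)"
proof -
  obtain A B where U: "U \<subseteq> space M \<times> space N" "\<And>n::nat. A n \<in> sets M \<and> B n \<in> sets N"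
    "marginally_null M N ((U - (\<Union>n. A n \<times> B n)) \<union> ((\<Union>n. A n \<times> B n) - U))"
    using assms(1) unfolding pseudo_open_def by blast
  obtain C D where V: "\<And>n::nat. C n \<in> sets M \<and> D n \<in> sets N"
    "marginally_null M N ((V - (\<Union>n. C n \<times> D n)) \<union> ((\<Union>n. C n \<times> D n) - V))"
    using assms(2) unfolding pseudo_open_def by blast
  obtain P Q where PQ: "P \<in> null_sets M" "Q \<in> null_sets N"
    "(U - (\<Union>n. A n \<times> B n)) \<union> ((\<Union>n. A n \<times> B n) - U) \<subseteq> P \<times> space N \<union> space M \<times> Q"
    using U(3) unfolding marginally_null_def by blast
  obtain P' Q' where PQ': "P' \<in> null_sets M" "Q' \<in> null_sets N"
    "(V - (\<Union>n. C n \<times> D n)) \<union> ((\<Union>n. C n \<times> D n) - V) \<subseteq> P' \<times> space N \<union> space M \<times> Q'"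
    using V(2) unfolding marginally_null_def by blast
  define R where "R = (\<lambda>n. A (fst (prod_decode n)) \<inter> C (snd (prod_decode n)))"
  define S where "S = (\<lambda>n. B (fst (prod_decode n)) \<inter> D (snd (prod_decode n)))"
  have RS: "(\<Union>n. R n \<times> S n) = (\<Union>n. A n \<times> B n) \<inter> (\<Union>n. C n \<times> D n)"
  proof (intro equalityI subsetI)
    fix p assume "p \<in> (\<Union>n. A n \<times> B n) \<inter> (\<Union>n. C n \<times> D n)"
    then obtain i j where "p \<in> A i \<times> B i" "p \<in> C j \<times> D j" by blast
    then have "p \<in> R (prod_encode (i, j)) \<times> S (prod_encode (i, j))" by (auto simp: R_def S_def)
    then show "p \<in> (\<Union>n. R n \<times> S n)" by blast
  qed (auto simp: R_def S_def)
  have "(U \<inter> V - (\<Union>n. R n \<times> S n)) \<union> ((\<Union>n. R n \<times> S n) - U \<inter> V)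
      \<subseteq> (P \<union> P') \<times> space N \<union> space M \<times> (Q \<union> Q')"
    unfolding RS using PQ(3) PQ'(3) by blast
  moreover have "(P \<union> P') \<times> space N \<union> space M \<times> (Q \<union> Q') \<subseteq> space M \<times> space N"
    using PQ(1,2) PQ'(1,2) by (auto dest!: null_setsD2 sets.sets_into_space)
  ultimately have "marginally_null M N ((U \<inter> V - (\<Union>n. R n \<times> S n)) \<union> ((\<Union>n. R n \<times> S n) - U \<inter> V))"
    unfolding marginally_null_def using PQ PQ' by (meson null_sets.Un order_trans)
  moreover have "R n \<in> sets M \<and> S n \<in> sets N" for n using U V by (auto simp: R_def S_def)
  ultimately show ?thesis using U(1) unfolding pseudo_open_def by blast
qed

lemma Phi0_add:
  assumes "F \<in> Phi0 M N K" "G \<in> Phi0 M N K"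
  shows "(\<lambda>p. F p + G p) \<in> Phi0 M N K"
  unfolding Phi0_iff
proof (intro conjI allI impI)
  show "(\<lambda>p. F p + G p) \<in> Gamma_space M N"
    using assms by (auto simp: Phi0_iff intro: Gamma_space_add)
  fix e :: real assume "e > 0"
  then have e2: "e / 2 > 0" by simp
  from assms(1) e2 obtain F' U where F': "F' \<in> Gamma_space M N" "pseudo_open M N U" "K \<subseteq> U"
    "vanishes_on M N F' U" "Gamma_below M N (e/2) (\<lambda>p. F p - F' p)" unfolding Phi0_iff by blast
  from assms(2) e2 obtain G' V where G': "G' \<in> Gamma_space M N" "pseudo_open M N V" "K \<subseteq> V"
    "vanishes_on M N G' V" "Gamma_below M N (e/2) (\<lambda>p. G p - G' p)" unfolding Phi0_iff by blast
  show "\<exists>H\<in>Gamma_space M N. (\<exists>U. pseudo_open M N U \<and> K \<subseteq> U \<and> vanishes_on M N H U) \<and>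
      Gamma_below M N e (\<lambda>p. F p + G p - H p)"
  proof (intro bexI conjI exI)
    show "(\<lambda>p. F' p + G' p) \<in> Gamma_space M N" by (rule Gamma_space_add[OF F'(1) G'(1)])
    show "pseudo_open M N (U \<inter> V)" by (rule pseudo_open_Int[OF F'(2) G'(2)])
    show "K \<subseteq> U \<inter> V" using F' G' by blast
    show "vanishes_on M N (\<lambda>p. F' p + G' p) (U \<inter> V)"
      using mae_conj[OF F'(4)[unfolded vanishes_on_def] G'(4)[unfolded vanishes_on_def]]
      unfolding vanishes_on_def by (rule mae_mono) (auto simp: indicator_def split: if_splits)
    show "Gamma_below M N e (\<lambda>p. F p + G p - (F' p + G' p))"
      using Gamma_below_add[OF F'(5) G'(5)] by (simp add: algebra_simps)
  qed
qed

lemma Phi0_zero: "K \<subseteq> space M \<times> space N \<Longrightarrow> (\<lambda>_. 0) \<in> Phi0 M N K"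
  unfolding Phi0_iff
proof (intro conjI allI impI)
  assume K: "K \<subseteq> space M \<times> space N"
  show z: "(\<lambda>_. 0) \<in> Gamma_space M N" unfolding Gamma_space_iff using Gamma_below_zero zero_less_one by blast
  fix e :: real assume "e > 0"
  have "pseudo_open M N (space M \<times> space N)"
    unfolding pseudo_open_def marginally_null_def
    by (auto intro!: exI[of _ "\<lambda>_. space M"] exI[of _ "\<lambda>_. space N"])
  then show "\<exists>G\<in>Gamma_space M N. (\<exists>U. pseudo_open M N U \<and> K \<subseteq> U \<and> vanishes_on M N G U) \<and>
      Gamma_below M N e (\<lambda>p. 0 - G p)"
    using K z Gamma_below_zero[OF \<open>e > 0\<close>] by (intro bexI[OF _ z]) (auto simp: vanishes_on_def intro!: mae_True)
qed

lemma Phi0_sum: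
  assumes "K \<subseteq> space M \<times> space N" "finite I" "\<And>i. i \<in> I \<Longrightarrow> F i \<in> Phi0 M N K"
  shows "(\<lambda>p. \<Sum>i\<in>I. F i p) \<in> Phi0 M N K"
  using assms(2,3) by (induction I rule: finite_induct) (auto intro: Phi0_zero[OF assms(1)] Phi0_add)

lemma Phi0_closed:
  assumes "F \<in> Gamma_space M N" "\<And>e. e > 0 \<Longrightarrow> \<exists>G \<in> Phi0 M N K. Gamma_below M N e (\<lambda>p. F p - G p)"
  shows "F \<in> Phi0 M N K"
  unfolding Phi0_iff
proof (intro conjI allI impI)
  fix e :: real assume "e > 0"
  then have e2: "e / 2 > 0" by simp
  from assms(2)[OF e2] obtain G where G: "G \<in> Phi0 M N K" "Gamma_below M N (e/2) (\<lambda>p. F p - G p)" by blast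
  from G(1) e2 obtain H where H: "H \<in> Gamma_space M N"
    "\<exists>U. pseudo_open M N U \<and> K \<subseteq> U \<and> vanishes_on M N H U" "Gamma_below M N (e/2) (\<lambda>p. G p - H p)"
    unfolding Phi0_iff by blast
  have "Gamma_below M N e (\<lambda>p. F p - H p)"
    using Gamma_below_add[OF G(2) H(3)] by simp
  then show "\<exists>G\<in>Gamma_space M N. (\<exists>U. pseudo_open M N U \<and> K \<subseteq> U \<and> vanishes_on M N G U) \<and>
      Gamma_below M N e (\<lambda>p. F p - G p)" using H by blast
qed (rule assms(1))

text \<open>The energies have a finite sum, so the sum of the square sums is integrable and hence finite
  almost everywhere; its terms then tend to zero.\<close>

lemma AE_tendsto_of_summable_energy:
  assumes m: "\<And>i n. h i n \<in> borel_measurable M" and e: "\<And>i. energy M (h i) < ennreal ((1/2)^i)"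
  shows "AE x in M. (\<lambda>i. sqsum (\<lambda>n. h i n x)) \<longlonglongrightarrow> 0"
proof -
  have "(\<integral>\<^sup>+x. (\<Sum>i. sqsum (\<lambda>n. h i n x)) \<partial>M) = (\<Sum>i. energy M (h i))"
    unfolding energy_def using m by (intro nn_integral_suminf) measurable
  also have "\<dots> \<le> (\<Sum>i. ennreal ((1/2)^i))" using e by (intro suminf_le) (auto intro: less_imp_le)
  also have "\<dots> < \<infinity>" by (subst suminf_ennreal2) auto
  finally have "AE x in M. (\<Sum>i. sqsum (\<lambda>n. h i n x)) \<noteq> \<infinity>"
    using m by (intro nn_integral_PInf_AE) (auto intro!: borel_measurable_suminf_order)
  then show ?thesis
  proof (rule AE_mp, intro AE_I2 impI)
    fix x assume fin: "(\<Sum>i. sqsum (\<lambda>n. h i n x)) \<noteq> \<infinity>"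
    show "(\<lambda>i. sqsum (\<lambda>n. h i n x)) \<longlonglongrightarrow> 0"
    proof -
      have "sqsum (\<lambda>n. h i n x) \<le> (\<Sum>i. sqsum (\<lambda>n. h i n x))" for i
        using sum_le_suminf[of "\<lambda>i. sqsum (\<lambda>n. h i n x)" "{i}"] by simp
      then have eq: "sqsum (\<lambda>n. h i n x) = ennreal (enn2real (sqsum (\<lambda>n. h i n x)))" for i
        using fin by (metis ennreal_enn2real infinity_ennreal_def le_less_trans top.not_eq_extremum)
      have "summable (\<lambda>i. enn2real (sqsum (\<lambda>n. h i n x)))"
        by (rule summable_suminf_not_top) (use fin eq in auto)
      from tendsto_ennrealI[OF summable_LIMSEQ_zero[OF this]]
      show ?thesis using eq by simp
    qed
  qed
qed

text \<open>Choose \<open>G i\<close> vanishing on \<open>K\<close> with \<open>F - G i\<close> of norm below \<open>2\<^sup>-\<^sup>i\<close>. A balanced representation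
  bounds \<open>\<bar>F - G i\<bar>\<close> by a function of \<open>x\<close> plus a function of \<open>y\<close>. Both tend to zero almost
  everywhere, and on \<open>K\<close> the bounded quantity is \<open>\<bar>F\<bar>\<close> for every \<open>i\<close>.\<close>

lemma Phi0_subset_Phi: "Phi0 M N K \<subseteq> Phi M N K"
proof
  fix F assume F: "F \<in> Phi0 M N K"
  have "\<forall>i. \<exists>Ghk. (vanishes_on M N (fst Ghk) K) \<and>
      balanced_rep M N (ennreal ((1/2)^i)) (\<lambda>p. F p - fst Ghk p) (fst (snd Ghk)) (snd (snd Ghk))"
  proof
    fix i :: nat
    have "(1/2)^i > (0::real)" by simp
    then obtain G U where G: "K \<subseteq> U" "vanishes_on M N G U" "Gamma_below M N ((1/2)^i) (\<lambda>p. F p - G p)"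
      using F unfolding Phi0_iff by blast
    obtain h k where "balanced_rep M N (ennreal ((1/2)^i)) (\<lambda>p. F p - G p) h k"
      using G(3) unfolding Gamma_below_def by blast
    moreover have "vanishes_on M N G K"
      using G(2) unfolding vanishes_on_def
      by (rule mae_mono) (use G(1) in \<open>auto simp: indicator_def split: if_splits\<close>)
    ultimately show "\<exists>Ghk. (vanishes_on M N (fst Ghk) K) \<and>
      balanced_rep M N (ennreal ((1/2)^i)) (\<lambda>p. F p - fst Ghk p) (fst (snd Ghk)) (snd (snd Ghk))"
      by (intro exI[of _ "(G, h, k)"]) simp
  qed
  from choice[OF this] obtain W where W: "\<And>i. vanishes_on M N (fst (W i)) K"
    "\<And>i. balanced_rep M N (ennreal ((1/2)^i)) (\<lambda>p. F p - fst (W i) p) (fst (snd (W i))) (snd (snd (W i)))"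
    by blast
  define G h k where "G i = fst (W i)" and "h i = fst (snd (W i))" and "k i = snd (snd (W i))" for i
  have r: "balanced_rep M N (ennreal ((1/2)^i)) (\<lambda>p. F p - G i p) (h i) (k i)" for i
    using W(2)[of i] by (simp add: G_def h_def k_def)
  have 1: "mae M N (\<lambda>p. \<forall>i. (case p of (x, y) \<Rightarrow> (\<lambda>n. h i n x * k i n y) sums (F (x, y) - G i (x, y)))
      \<and> G i p * indicator K p = 0)"
    using r W(1) by (intro mae_all mae_conj) (auto simp: balanced_rep_def vanishes_on_def G_def)
  have 2: "mae M N (\<lambda>p. (\<lambda>i. sqsum (\<lambda>n. h i n (fst p))) \<longlonglongrightarrow> 0)"
    using r by (intro mae_fst AE_tendsto_of_summable_energy) (auto simp: balanced_rep_def)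
  have 3: "mae M N (\<lambda>p. (\<lambda>i. sqsum (\<lambda>n. k i n (snd p))) \<longlonglongrightarrow> 0)"
    using r by (intro mae_snd AE_tendsto_of_summable_energy) (auto simp: balanced_rep_def)
  have "vanishes_on M N F K"
    unfolding vanishes_on_def
  proof (rule mae_mono[OF mae_conj[OF 1 mae_conj[OF 2 3]]])
    fix p assume a: "(\<forall>i. (case p of (x, y) \<Rightarrow> (\<lambda>n. h i n x * k i n y) sums (F (x, y) - G i (x, y)))
      \<and> G i p * indicator K p = 0) \<and> (\<lambda>i. sqsum (\<lambda>n. h i n (fst p))) \<longlonglongrightarrow> 0 \<and>
      (\<lambda>i. sqsum (\<lambda>n. k i n (snd p))) \<longlonglongrightarrow> 0"
    obtain x y where p: "p = (x, y)" by force
    show "F p * indicator K p = 0"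
    proof (cases "p \<in> K")
      case True
      then have "G i p = 0" for i using a by auto
      then have s: "(\<lambda>n. h i n x * k i n y) sums F (x, y)" for i
        using a p by (metis (no_types, lifting) case_prod_conv diff_zero)
      have "ennreal (cmod (F p)) \<le> sqsum (\<lambda>n. h i n x) + sqsum (\<lambda>n. k i n y)" for i
        using cmod_sums_le_sqsum[OF s] p by simp
      moreover have "(\<lambda>i. sqsum (\<lambda>n. h i n x) + sqsum (\<lambda>n. k i n y)) \<longlonglongrightarrow> 0 + 0"
        using a p by (intro tendsto_add) auto
      ultimately have "ennreal (cmod (F p)) \<le> 0 + 0"
        by (intro LIMSEQ_le_const) auto
      then show ?thesis by simp
    qed simp
  qed
  then show "F \<in> Phi M N K" using F by (simp add: Phi_def Phi0_iff)
qed

section \<open>Inverse images under nonsingular maps\<close>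

definition nonsingular_map :: "'a measure \<Rightarrow> 'b measure \<Rightarrow> ('a \<Rightarrow> 'b) \<Rightarrow> bool" where
  "nonsingular_map M N \<phi> \<longleftrightarrow>
     \<phi> \<in> measurable M N \<and> (\<forall>A \<in> null_sets N. \<phi> -` A \<inter> space M \<in> null_sets M)"

lemma nonsingular_map_of_absolutely_continuous:
  assumes "\<phi> \<in> measurable M N" "absolutely_continuous N (distr M N \<phi>)"
  shows "nonsingular_map M N \<phi>"
  unfolding nonsingular_map_def
proof (intro conjI ballI)
  fix A assume A: "A \<in> null_sets N"
  then have "A \<in> null_sets (distr M N \<phi>)" using assms(2) unfolding absolutely_continuous_def by blast
  then show "\<phi> -` A \<inter> space M \<in> null_sets M"
    using A assms(1) by (auto simp: null_sets_def emeasure_distr measurable_sets)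
qed (rule assms(1))

lemma mae_vimage:
  assumes "nonsingular_map M M1 \<phi>" "nonsingular_map N N1 \<psi>" "mae M1 N1 P"
  shows "mae M N (\<lambda>p. P (map_prod \<phi> \<psi> p))"
proof -
  obtain A B where AB: "A \<in> null_sets M1" "B \<in> null_sets N1"
    "\<forall>u \<in> space M1 - A. \<forall>v \<in> space N1 - B. P (u, v)" using assms(3) unfolding mae_iff by blast
  have "\<phi> x \<in> space M1" if "x \<in> space M" for x
    using assms(1) that by (auto simp: nonsingular_map_def dest: measurable_space)
  moreover have "\<psi> y \<in> space N1" if "y \<in> space N" for y
    using assms(2) that by (auto simp: nonsingular_map_def dest: measurable_space)
  ultimately have "\<forall>x \<in> space M - (\<phi> -` A \<inter> space M). \<forall>y \<in> space N - (\<psi> -` B \<inter> space N).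
      P (map_prod \<phi> \<psi> (x, y))"
    unfolding map_prod_simp by (intro ballI AB(3)[rule_format]) auto
  moreover have "\<phi> -` A \<inter> space M \<in> null_sets M" "\<psi> -` B \<inter> space N \<in> null_sets N"
    using AB(1,2) assms(1,2) by (auto simp: nonsingular_map_def)
  ultimately show ?thesis unfolding mae_iff by blast
qed

abbreviation (input) prod_vimage where
  "prod_vimage M N \<phi> \<psi> K \<equiv> map_prod \<phi> \<psi> -` K \<inter> (space M \<times> space N)"

lemma pseudo_open_vimage:
  assumes "nonsingular_map M M1 \<phi>" "nonsingular_map N N1 \<psi>" "pseudo_open M1 N1 U"
  shows "pseudo_open M N (prod_vimage M N \<phi> \<psi> U)"
proof -
  have m: "\<phi> \<in> measurable M M1" "\<psi> \<in> measurable N N1" using assms by (auto simp: nonsingular_map_def)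
  obtain A B where AB: "\<And>n::nat. A n \<in> sets M1 \<and> B n \<in> sets N1"
    "marginally_null M1 N1 ((U - (\<Union>n. A n \<times> B n)) \<union> ((\<Union>n. A n \<times> B n) - U))"
    using assms(3) unfolding pseudo_open_def by blast
  let ?R = "\<Union>n. A n \<times> B n"
  let ?R' = "\<Union>n. (\<phi> -` A n \<inter> space M) \<times> (\<psi> -` B n \<inter> space N)"
  let ?U' = "prod_vimage M N \<phi> \<psi> U"
  have "{p \<in> space M1 \<times> space N1. \<not> (p \<in> U \<longleftrightarrow> p \<in> ?R)} = (U - ?R) \<union> (?R - U)"
  proof -
    have "(U - ?R) \<union> (?R - U) \<subseteq> space M1 \<times> space N1" using AB(2) unfolding marginally_null_def by blast
    then show ?thesis by blast
  qed
  then have "mae M1 N1 (\<lambda>p. p \<in> U \<longleftrightarrow> p \<in> ?R)" unfolding mae_def using AB(2) by simp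
  from mae_vimage[OF assms(1,2) this] have "mae M N (\<lambda>p. p \<in> ?U' \<longleftrightarrow> p \<in> ?R')"
    by (rule mae_mono) auto
  moreover have "{p \<in> space M \<times> space N. \<not> (p \<in> ?U' \<longleftrightarrow> p \<in> ?R')} = (?U' - ?R') \<union> (?R' - ?U')" by blast
  ultimately have "marginally_null M N ((?U' - ?R') \<union> (?R' - ?U'))" unfolding mae_def by simp
  then show ?thesis
    unfolding pseudo_open_def using AB(1) m
    by (intro conjI exI[of _ "\<lambda>n. \<phi> -` A n \<inter> space M"] exI[of _ "\<lambda>n. \<psi> -` B n \<inter> space N"] allI)
      (auto intro: measurable_sets)
qed

lemma pseudo_closed_vimage:
  assumes "nonsingular_map M M1 \<phi>" "nonsingular_map N N1 \<psi>" "pseudo_closed M1 N1 K"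
  shows "pseudo_closed M N (prod_vimage M N \<phi> \<psi> K)"
proof -
  have m: "\<phi> \<in> measurable M M1" "\<psi> \<in> measurable N N1" using assms by (auto simp: nonsingular_map_def)
  have "prod_vimage M N \<phi> \<psi> (space M1 \<times> space N1 - K) = space M \<times> space N - prod_vimage M N \<phi> \<psi> K"
    using measurable_space[OF m(1)] measurable_space[OF m(2)] by auto
  then show ?thesis
    using pseudo_open_vimage[OF assms(1,2), of "space M1 \<times> space N1 - K"] assms(3)
    unfolding pseudo_closed_def by auto
qed

text \<open>On \<open>A\<close> the push-forward of \<open>M\<close> is at most \<open>C\<close> times \<open>N\<close>, so composition with \<open>\<phi>\<close>
  followed by restriction to \<open>A\<close> is bounded from \<open>L\<^sub>2 N\<close> to \<open>L\<^sub>2 M\<close>. Absolute continuity alone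
  does not give such a bound on the whole space.\<close>

definition dominated_on :: "'a measure \<Rightarrow> 'b measure \<Rightarrow> ('a \<Rightarrow> 'b) \<Rightarrow> real \<Rightarrow> 'a set \<Rightarrow> bool" where
  "dominated_on M N \<phi> C A \<longleftrightarrow> A \<in> sets M \<and>
     (\<forall>g \<in> borel_measurable N. (\<integral>\<^sup>+x. indicator A x * g (\<phi> x) \<partial>M) \<le> ennreal C * (\<integral>\<^sup>+u. g u \<partial>N))"

lemma dominated_on_subset:
  assumes "dominated_on M N \<phi> C A" "B \<subseteq> A" "B \<in> sets M"
  shows "dominated_on M N \<phi> C B"
  unfolding dominated_on_def
proof (intro conjI ballI)
  fix g :: "'b \<Rightarrow> ennreal" assume "g \<in> borel_measurable N"
  have "(\<integral>\<^sup>+x. indicator B x * g (\<phi> x) \<partial>M) \<le> (\<integral>\<^sup>+x. indicator A x * g (\<phi> x) \<partial>M)"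
    using assms(2) by (intro nn_integral_mono) (auto simp: indicator_def)
  then show "(\<integral>\<^sup>+x. indicator B x * g (\<phi> x) \<partial>M) \<le> ennreal C * (\<integral>\<^sup>+u. g u \<partial>N)"
    using assms(1) \<open>g \<in> borel_measurable N\<close> unfolding dominated_on_def by (meson order_trans)
qed (rule assms(3))

lemma dominated_on_mono:
  assumes "dominated_on M N \<phi> C A" "C \<le> D"
  shows "dominated_on M N \<phi> D A"
  unfolding dominated_on_def
proof (intro conjI ballI)
  fix g :: "'b \<Rightarrow> ennreal" assume "g \<in> borel_measurable N"
  moreover have "ennreal C * (\<integral>\<^sup>+u. g u \<partial>N) \<le> ennreal D * (\<integral>\<^sup>+u. g u \<partial>N)"
    using assms(2) by (intro mult_right_mono ennreal_leI) auto
  ultimately show "(\<integral>\<^sup>+x. indicator A x * g (\<phi> x) \<partial>M) \<le> ennreal D * (\<integral>\<^sup>+u. g u \<partial>N)"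
    using assms(1) unfolding dominated_on_def by (meson order_trans)
qed (use assms in \<open>simp add: dominated_on_def\<close>)

lemma sqsum_indicator: "sqsum (\<lambda>n. indicator A x * a n) = indicator A x * sqsum a"
  by (simp add: sqsum_scale indicator_def)

lemma energy_pullback_le:
  assumes "dominated_on M N \<phi> C A" "\<And>n. h n \<in> borel_measurable N"
  shows "energy M (\<lambda>n x. indicator A x * h n (\<phi> x)) \<le> ennreal C * energy N h"
  using assms(1) sqsum_measurable[of h, OF assms(2)]
  unfolding energy_def sqsum_indicator dominated_on_def by (auto dest: bspec)

definition pullback_on ::
    "('a \<Rightarrow> 'c) \<Rightarrow> ('b \<Rightarrow> 'd) \<Rightarrow> 'a set \<Rightarrow> 'b set \<Rightarrow> ('c \<times> 'd \<Rightarrow> complex) \<Rightarrow> 'a \<times> 'b \<Rightarrow> complex" where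
  "pullback_on \<phi> \<psi> A B G = (\<lambda>(x, y). indicator A x * indicator B y * G (\<phi> x, \<psi> y))"

lemma Gamma_below_pullback:
  assumes \<phi>: "nonsingular_map M M1 \<phi>" and \<psi>: "nonsingular_map N N1 \<psi>"
    and A: "dominated_on M M1 \<phi> C A" and B: "dominated_on N N1 \<psi> C B" and C: "C > 0"
    and G: "Gamma_below M1 N1 c G"
  shows "Gamma_below M N (C * c) (pullback_on \<phi> \<psi> A B G)"
proof -
  obtain h k where r: "balanced_rep M1 N1 (ennreal c) G h k" using G by (auto simp: Gamma_below_def)
  have [measurable]: "\<phi> \<in> measurable M M1" "\<psi> \<in> measurable N N1" "A \<in> sets M" "B \<in> sets N"
    using \<phi> \<psi> A B by (auto simp: nonsingular_map_def dominated_on_def)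
  have [measurable]: "h n \<in> borel_measurable M1" "k n \<in> borel_measurable N1" for n
    using r by (auto simp: balanced_rep_def)
  have c: "c > 0" by (rule balanced_rep_pos[OF r])
  have "mae M1 N1 (\<lambda>(u, v). (\<lambda>n. h n u * k n v) sums G (u, v))" using r by (simp add: balanced_rep_def)
  from mae_vimage[OF \<phi> \<psi> this]
  have "mae M N (\<lambda>(x, y). (\<lambda>n. (indicator A x * h n (\<phi> x)) * (indicator B y * k n (\<psi> y)))
      sums pullback_on \<phi> \<psi> A B G (x, y))"
    by (rule mae_mono) (auto simp: pullback_on_def indicator_def)
  moreover have en: "energy Q (\<lambda>n x. indicator S x * a n (\<xi> x)) < ennreal (C * c)"
    if "dominated_on Q R \<xi> C S" "\<And>n. a n \<in> borel_measurable R" "energy R a < ennreal c"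
    for Q :: "'z measure" and R :: "'w measure" and \<xi> S a
  proof -
    have "energy Q (\<lambda>n x. indicator S x * a n (\<xi> x)) \<le> ennreal C * energy R a"
      by (rule energy_pullback_le[OF that(1,2)])
    also have "\<dots> < ennreal C * ennreal c" using that(3) C by (intro ennreal_mult_strict_left_mono) auto
    also have "\<dots> = ennreal (C * c)" using C c by (simp add: ennreal_mult)
    finally show ?thesis .
  qed
  ultimately have "balanced_rep M N (ennreal (C * c)) (pullback_on \<phi> \<psi> A B G)
      (\<lambda>n x. indicator A x * h n (\<phi> x)) (\<lambda>n y. indicator B y * k n (\<psi> y))"
    using r unfolding balanced_rep_def by (auto intro!: en[OF A] en[OF B])
  then show ?thesis unfolding Gamma_below_def by blast
qed

text \<open>Pulling back along \<open>\<phi> \<times> \<psi>\<close> is bounded on the rectangle \<open>A \<times> B\<close>, and it takes pseudo-open sets to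
  pseudo-open sets. So it maps functions vanishing near \<open>K\<close>, and their limits, to functions of the
  same kind for the inverse image.\<close>

lemma Phi0_pullback:
  assumes \<phi>: "nonsingular_map M M1 \<phi>" and \<psi>: "nonsingular_map N N1 \<psi>"
    and "dominated_on M M1 \<phi> C A" "dominated_on N N1 \<psi> D B" and F: "F \<in> Phi0 M1 N1 K"
  shows "pullback_on \<phi> \<psi> A B F \<in> Phi0 M N (prod_vimage M N \<phi> \<psi> K)"
proof -
  define c where "c = max 1 (max C D)"
  have c: "c > 0" by (simp add: c_def)
  have A: "dominated_on M M1 \<phi> c A" and B: "dominated_on N N1 \<psi> c B"
    using assms(3,4) by (auto simp: c_def intro: dominated_on_mono)
  note below = Gamma_below_pullback[OF \<phi> \<psi> A B c]
  have Gam: "pullback_on \<phi> \<psi> A B G \<in> Gamma_space M N" if "G \<in> Gamma_space M1 N1" for G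
    using that below unfolding Gamma_space_iff by blast
  show ?thesis
    unfolding Phi0_iff
  proof (intro conjI allI impI)
    show "pullback_on \<phi> \<psi> A B F \<in> Gamma_space M N" using F by (intro Gam) (simp add: Phi0_iff)
    fix e :: real assume "e > 0"
    then have "e / c > 0" using c by simp
    then obtain G U where G: "G \<in> Gamma_space M1 N1" "pseudo_open M1 N1 U" "K \<subseteq> U"
      "vanishes_on M1 N1 G U" "Gamma_below M1 N1 (e/c) (\<lambda>p. F p - G p)"
      using F unfolding Phi0_iff by blast
    show "\<exists>H\<in>Gamma_space M N. (\<exists>U. pseudo_open M N U \<and> prod_vimage M N \<phi> \<psi> K \<subseteq> U \<and> vanishes_on M N H U) \<and>
        Gamma_below M N e (\<lambda>p. pullback_on \<phi> \<psi> A B F p - H p)"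
    proof (intro bexI conjI exI)
      show "pullback_on \<phi> \<psi> A B G \<in> Gamma_space M N" by (rule Gam[OF G(1)])
      show "pseudo_open M N (prod_vimage M N \<phi> \<psi> U)" by (rule pseudo_open_vimage[OF \<phi> \<psi> G(2)])
      show "prod_vimage M N \<phi> \<psi> K \<subseteq> prod_vimage M N \<phi> \<psi> U" using G(3) by blast
      show "vanishes_on M N (pullback_on \<phi> \<psi> A B G) (prod_vimage M N \<phi> \<psi> U)"
        using mae_vimage[OF \<phi> \<psi> G(4)[unfolded vanishes_on_def]] unfolding vanishes_on_def
        by (rule mae_mono) (auto simp: pullback_on_def indicator_def split: if_splits)
      have "(\<lambda>p. pullback_on \<phi> \<psi> A B F p - pullback_on \<phi> \<psi> A B G p) = pullback_on \<phi> \<psi> A B (\<lambda>p. F p - G p)"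
        by (auto simp: pullback_on_def algebra_simps)
      then show "Gamma_below M N e (\<lambda>p. pullback_on \<phi> \<psi> A B F p - pullback_on \<phi> \<psi> A B G p)"
        using below[OF G(5)] c by simp
    qed
  qed
qed


section \<open>Measurable sections over standard Borel spaces\<close>

text \<open>Select the lexicographic minimum of each set. Minimising the coordinates one after the other
  yields a decreasing sequence of compact sets that shrinks to one point. At each stage the set of
  parameters whose compact set meets a given closed set stays measurable, and at the end this says
  that the selection is measurable.\<close>

lemma compact_valued_selection:
  fixes G :: "'a \<Rightarrow> (nat \<Rightarrow> real) set"
  assumes ne: "\<And>u. u \<in> space M \<Longrightarrow> G u \<noteq> {}"
    and cpt: "\<And>u. u \<in> space M \<Longrightarrow> compact (G u)"
    and hit: "\<And>C. closed C \<Longrightarrow> {u \<in> space M. G u \<inter> C \<noteq> {}} \<in> sets M"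
  obtains s where "s \<in> borel_measurable M" "\<And>u. u \<in> space M \<Longrightarrow> s u \<in> G u"
proof -
  define H where "H = rec_nat G (\<lambda>n K u. {t \<in> K u. \<forall>t' \<in> K u. t n \<le> t' n})"
  have H0: "H 0 = G" and HS: "H (Suc n) u = {t \<in> H n u. \<forall>t' \<in> H n u. t n \<le> t' n}" for n u
    by (simp_all add: H_def)
  have cont: "continuous_on A (\<lambda>t::nat \<Rightarrow> real. t n)" for n A
    by (rule continuous_on_subset[OF continuous_on_product_coordinates]) simp
  have closed_le: "closed {t::nat \<Rightarrow> real. t n \<le> r}" for n r
    by (rule closed_Collect_le) (auto intro: cont)
  have HC: "H n u \<noteq> {} \<and> compact (H n u)" if u: "u \<in> space M" for n u
  proof (induction n)
    case 0
    show ?case using ne[OF u] cpt[OF u] by (simp add: H0)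
  next
    case (Suc n)
    from continuous_attains_inf[OF _ _ cont[of "H n u" n]] Suc
    obtain t where t: "t \<in> H n u" "\<forall>t' \<in> H n u. t n \<le> t' n" by blast
    have "H (Suc n) u = H n u \<inter> {s. s n \<le> t n}"
      using t by (auto simp: HS intro: order_trans)
    then show ?case
      using t Suc by (auto simp: HS intro!: compact_Int_closed closed_le)
  qed
  have hitH: "{u \<in> space M. H n u \<inter> C \<noteq> {}} \<in> sets M" if "closed C" for n C
    using that
  proof (induction n arbitrary: C)
    case 0
    then show ?case by (simp add: H0 hit)
  next
    case (Suc n)
    let ?h = "\<lambda>C. {u \<in> space M. H n u \<inter> C \<noteq> {}}"
    let ?L = "\<lambda>r::rat. {t. t n \<le> real_of_rat r}"
    \<comment> \<open>the minimum of the \<open>n\<close>th coordinate is attained outside \<open>C\<close> only, iff a rational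
      level separates it from the minimum over the part in \<open>C\<close>\<close>
    have "{u \<in> space M. H (Suc n) u \<inter> C \<noteq> {}} = space M - (\<Union>r. ?h (?L r) - ?h (C \<inter> ?L r))"
    proof (intro equalityI subsetI)
      fix u assume "u \<in> {u \<in> space M. H (Suc n) u \<inter> C \<noteq> {}}"
      then obtain t where u: "u \<in> space M" and t: "t \<in> H n u" "t \<in> C" "\<forall>t' \<in> H n u. t n \<le> t' n"
        by (auto simp: HS)
      have "u \<in> ?h (C \<inter> ?L r)" if "u \<in> ?h (?L r)" for r
      proof -
        obtain t' where "t' \<in> H n u" "t' n \<le> real_of_rat r" using \<open>u \<in> ?h (?L r)\<close> by blast
        then have "t \<in> ?L r" using t(3) order_trans by blast
        then show ?thesis using u t by blast
      qed
      then show "u \<in> space M - (\<Union>r. ?h (?L r) - ?h (C \<inter> ?L r))"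
        using u by blast
    next
      fix u assume asm: "u \<in> space M - (\<Union>r. ?h (?L r) - ?h (C \<inter> ?L r))"
      then have u: "u \<in> space M" by simp
      from continuous_attains_inf[OF _ _ cont[of "H n u" n]] HC[OF u, of n]
      obtain t where t: "t \<in> H n u" "\<forall>t' \<in> H n u. t n \<le> t' n" by blast
      have key: "\<exists>s \<in> H n u \<inter> C. s n \<le> real_of_rat r" if "t n \<le> real_of_rat r" for r
        using asm t that by auto
      obtain r0 where r0: "t n \<le> real_of_rat r0"
        by (metis ex_le_of_int of_rat_of_int_eq)
      then have "H n u \<inter> C \<noteq> {}" using key by blast
      moreover have "compact (H n u \<inter> C)" using HC[OF u, of n] Suc.prems by blast
      ultimately obtain s where s: "s \<in> H n u" "s \<in> C" "\<forall>t' \<in> H n u \<inter> C. s n \<le> t' n"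
        using continuous_attains_inf[OF _ _ cont[of "H n u \<inter> C" n]] by blast
      have "s n \<le> t n"
      proof (rule ccontr)
        assume "\<not> s n \<le> t n"
        then obtain r where r: "t n < real_of_rat r" "real_of_rat r < s n"
          using of_rat_dense by (meson not_le)
        then obtain s' where "s' \<in> H n u \<inter> C" "s' n \<le> real_of_rat r" using key[of r] by auto
        then show False using s r by force
      qed
      then have "s \<in> H (Suc n) u" using s t by (auto simp: HS intro: order_trans)
      then show "u \<in> {u \<in> space M. H (Suc n) u \<inter> C \<noteq> {}}" using u s by blast
    qed
    moreover have "(\<Union>r. ?h (?L r) - ?h (C \<inter> ?L r)) \<in> sets M"
    proof (rule sets.countable_UN'')
      fix r :: rat
      have "?h (?L r) \<in> sets M" "?h (C \<inter> ?L r) \<in> sets M"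
        using Suc.prems by (intro Suc.IH closed_Int closed_le; assumption)+
      then show "?h (?L r) - ?h (C \<inter> ?L r) \<in> sets M" by (rule sets.Diff)
    qed auto
    ultimately show ?case by simp
  qed
  have dec: "H m u \<subseteq> H n u" if "n \<le> m" for n m u
    using that by (induction rule: dec_induct) (auto simp: HS)
  have inter: "(\<Inter>n. H n u \<inter> C) \<noteq> {}" if "u \<in> space M" "closed C" "\<And>n. H n u \<inter> C \<noteq> {}" for u C
  proof -
    have "G u \<inter> (\<Inter>n\<in>UNIV. H n u \<inter> C) \<noteq> {}"
    proof (rule compact_imp_fip_image)
      show "compact (G u)" by (rule cpt[OF that(1)])
      show "closed (H n u \<inter> C)" for n
        using HC[OF that(1)] that(2) by (auto intro: compact_imp_closed)
      fix I :: "nat set" assume "finite I"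
      then obtain k where k: "\<forall>i \<in> I. i \<le> k" using finite_nat_set_iff_bounded_le by auto
      have "H k u \<inter> C \<subseteq> G u \<inter> (\<Inter>n\<in>I. H n u \<inter> C)"
        using dec[of _ k u] k H0 by fastforce
      then show "G u \<inter> (\<Inter>n\<in>I. H n u \<inter> C) \<noteq> {}" using that(3)[of k] by blast
    qed
    then show ?thesis by blast
  qed
  define s where "s u = (SOME t. t \<in> (\<Inter>n. H n u))" for u
  have s: "s u \<in> H n u" if "u \<in> space M" for u n
  proof -
    have "(\<Inter>n. H n u) \<noteq> {}" using inter[OF that, of UNIV] HC[OF that] by auto
    then have "s u \<in> (\<Inter>n. H n u)" unfolding s_def by (metis some_in_eq)
    then show ?thesis by blast
  qed
  have uniq: "t = s u" if "u \<in> space M" "\<And>n. t \<in> H n u" for t u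
  proof
    fix n show "t n = s u n"
      using that(2)[of "Suc n"] s[OF that(1), of "Suc n"] by (auto simp: HS intro!: antisym)
  qed
  have "s \<in> borel_measurable M"
    unfolding borel_eq_closed
  proof (rule measurable_measure_of)
    fix C :: "(nat \<Rightarrow> real) set" assume "C \<in> Collect closed"
    then have C: "closed C" by simp
    have "s -` C \<inter> space M = (\<Inter>n. {u \<in> space M. H n u \<inter> C \<noteq> {}})"
    proof (intro equalityI subsetI)
      fix u assume "u \<in> s -` C \<inter> space M"
      then show "u \<in> (\<Inter>n. {u \<in> space M. H n u \<inter> C \<noteq> {}})" using s by blast
    next
      fix u assume "u \<in> (\<Inter>n. {u \<in> space M. H n u \<inter> C \<noteq> {}})"
      then have u: "u \<in> space M" "\<And>n. H n u \<inter> C \<noteq> {}" by auto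
      with inter[OF u(1) C] obtain t where "\<And>n. t \<in> H n u \<inter> C" by blast
      with uniq[OF u(1), of t] u(1) show "u \<in> s -` C \<inter> space M" by auto
    qed
    then show "s -` C \<inter> space M \<in> sets M" using hitH[OF C] by auto
  qed auto
  moreover have "s u \<in> G u" if "u \<in> space M" for u
    using s[OF that, of 0] by (simp add: H0)
  ultimately show thesis using that by blast
qed

text \<open>The distances to a dense sequence embed a Polish space in the space of real sequences. The image
  is again completely metrizable, hence a \<open>G\<^sub>\<delta>\<close> set. This transfers measures on an abstract standard
  Borel space to a Polish type, where they are inner regular.\<close>

lemma standard_borel_embedding:
  assumes "standard_borel M"
  obtains j :: "'a \<Rightarrow> nat \<Rightarrow> real" where
    "inj_on j (space M)" "j \<in> borel_measurable M" "\<And>A. A \<in> sets M \<Longrightarrow> j ` A \<in> sets borel"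
proof -
  obtain T where T: "topspace T = space M" "completely_metrizable_space T" "second_countable T"
    and setsM: "sets M = sigma_sets (space M) {U. openin T U}"
    using assms unfolding standard_borel_def by blast
  obtain S d where Sd: "Metric_space S d" and T_eq: "T = Metric_space.mtopology S d"
    using T(2) unfolding completely_metrizable_space_def by blast
  interpret Metric_space S d by (rule Sd)
  have S: "space M = S" using T(1) T_eq by simp
  obtain Q where Q: "countable Q" "Q \<subseteq> S" "T closure_of Q = S"
    using second_countable_imp_separable_space[OF T(3)] T_eq unfolding separable_space_def by auto
  show thesis
  proof (cases "S = {}")
    case True
    then have "space M = {}" using S by simp
    then show thesis
      by (intro that[of "\<lambda>_ _. 0"]) (auto simp: measurable_def dest: sets.sets_into_space)
  next
    case False
    then have "Q \<noteq> {}" using Q(3) by auto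
    then obtain q :: "nat \<Rightarrow> 'a" where q: "range q = Q" using Q(1) by (metis range_from_nat_into)
    have qS: "q n \<in> S" for n using q Q(2) by auto
    define j where "j x = (\<lambda>n. d x (q n))" for x
    have dense: "\<exists>n. d x (q n) < e" if "x \<in> S" "e > 0" for x e
    proof -
      have "x \<in> T closure_of Q" using Q(3) that by simp
      moreover have "openin T (mball x e)" using T_eq by simp
      ultimately have "\<exists>y \<in> Q. y \<in> mball x e"
        using that unfolding in_closure_of by (metis centre_in_mball_iff)
      then show ?thesis using q by auto
    qed
    have contj: "continuous_map T euclidean j"
      unfolding euclidean_product_topology[symmetric] continuous_map_componentwise_UNIV
    proof
      fix n
      have "continuous_map T euclideanreal (\<lambda>x. d x (q n))"
        using continuous_map_mdist[of mtopology Self "\<lambda>x. x" "\<lambda>_. q n"] qS T_eq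
        by (simp add: mtopology_of_def)
      then show "continuous_map T euclidean (\<lambda>x. j x n)" by (simp add: j_def)
    qed
    have nbd: "\<exists>V. open V \<and> j x \<in> V \<and> (\<forall>y \<in> S. j y \<in> V \<longrightarrow> y \<in> U)"
      if "openin T U" "x \<in> U" for x U
    proof -
      have US: "U \<subseteq> S" and "\<forall>x. x \<in> U \<longrightarrow> (\<exists>r>0. mball x r \<subseteq> U)"
        using that(1) unfolding T_eq openin_mtopology by auto
      with that(2) obtain r where r: "r > 0" "mball x r \<subseteq> U" by auto
      have xS: "x \<in> S" using US that(2) by blast
      obtain n where n: "d x (q n) < r / 2" using dense[OF xS, of "r/2"] r by auto
      have "open {t::nat \<Rightarrow> real. t n < r / 2}"
        by (intro open_Collect_less continuous_on_product_coordinates continuous_on_const)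
      moreover have "y \<in> U" if "y \<in> S" "d y (q n) < r / 2" for y
      proof -
        have "d x y \<le> d x (q n) + d (q n) y" using triangle xS that(1) qS by blast
        then have "y \<in> mball x r" using n that xS commute[of y "q n"] by auto
        then show ?thesis using r by blast
      qed
      ultimately show ?thesis using n
        by (intro exI[of _ "{t. t n < r / 2}"]) (auto simp: j_def)
    qed
    have inj: "inj_on j S"
    proof (rule inj_onI)
      fix x y assume xy: "x \<in> S" "y \<in> S" "j x = j y"
      show "x = y"
      proof (rule ccontr)
        assume "x \<noteq> y"
        then have "openin T (mball x (d x y))" "x \<in> mball x (d x y)" using xy T_eq by auto
        then show False using nbd[of "mball x (d x y)" x] xy by auto
      qed
    qed
    have img: "\<exists>V. open V \<and> j ` U = j ` S \<inter> V" if U: "openin T U" for U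
    proof -
      have US: "U \<subseteq> S" using U T_eq by (metis openin_subset topspace_mtopology)
      define W where "W = \<Union>{V. open V \<and> (\<forall>y \<in> S. j y \<in> V \<longrightarrow> y \<in> U)}"
      have "open W" unfolding W_def by auto
      moreover have "j ` U = j ` S \<inter> W"
        using nbd[OF U] US unfolding W_def by blast
      ultimately show ?thesis by blast
    qed
    have "homeomorphic_map T (subtopology euclidean (j ` S)) j"
    proof (rule bijective_open_imp_homeomorphic_map)
      show "continuous_map T (top_of_set (j ` S)) j"
        using contj T_eq by (auto simp: continuous_map_in_subtopology)
      show "open_map T (top_of_set (j ` S)) j"
        using img by (auto simp: open_map_def openin_open)
      show "j ` topspace T = topspace (top_of_set (j ` S))" using T_eq by simp
      show "inj_on j (topspace T)" using inj T_eq by simp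
    qed
    then have "completely_metrizable_space (top_of_set (j ` S))"
      using T(2) homeomorphic_completely_metrizable_space homeomorphic_space by blast
    then have "gdelta_in euclidean (j ` S)"
      using completely_metrizable_space_imp_gdelta_in[of euclidean "j ` S"]
      by (simp add: metrizable_space_euclidean)
    then obtain \<U> where \<U>: "countable \<U>" "\<U> \<subseteq> Collect open" "\<Inter>\<U> = j ` S"
      by (auto simp: gdelta_in_alt intersection_of_def)
    have "(\<Inter>V\<in>\<U>. V) \<in> sets borel"
      using \<U>(1,2) by (intro sets.countable_INT'') auto
    then have bS: "j ` S \<in> sets borel" using \<U>(3) by simp
    have meas: "j \<in> borel_measurable M"
    proof (rule borel_measurableI)
      fix V :: "(nat \<Rightarrow> real) set" assume "open V"
      then have "openin T {x \<in> topspace T. j x \<in> V}"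
        using contj unfolding continuous_map by auto
      moreover have "j -` V \<inter> space M = {x \<in> topspace T. j x \<in> V}" using T(1) by auto
      ultimately show "j -` V \<inter> space M \<in> sets M" unfolding setsM by (auto intro: sigma_sets.Basic)
    qed
    have "j ` A \<in> sets borel" if "A \<in> sets M" for A
      using that unfolding setsM S
    proof (induction rule: sigma_sets.induct)
      case (Basic U)
      then obtain V where "open V" "j ` U = j ` S \<inter> V" using img[of U] by blast
      then show ?case using bS by auto
    next
      case (Compl A)
      moreover have "A \<subseteq> S"
        using Compl(1) by (rule sigma_sets_into_sp[rotated]) (use T_eq openin_subset in fastforce)
      ultimately show ?case using inj bS by (auto simp: inj_on_image_set_diff)
    next
      case (Union A)
      then show ?case by (auto simp: image_UN)
    qed simp
    then show thesis using that inj meas S by auto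
  qed
qed

text \<open>Over a compact set of pairs everything needed for a selection is closed: the projection of a
  compact set is compact, so the parameters whose fibre meets a closed set form a measurable set.\<close>

lemma compact_graph_section:
  fixes i :: "'b \<Rightarrow> nat \<Rightarrow> real" and K :: "((nat \<Rightarrow> real) \<times> (nat \<Rightarrow> real)) set"
  assumes i: "i \<in> borel_measurable N" and K: "compact K"
  defines "D \<equiv> {u \<in> space N. i u \<in> fst ` K}"
  obtains s where "D \<in> sets N" "s \<in> borel_measurable (restrict_space N D)"
    "\<And>u. u \<in> D \<Longrightarrow> (i u, s u) \<in> K"
proof -
  have hit: "{u \<in> space N. i u \<in> fst ` L} \<in> sets N" if "compact L" for L :: "((nat \<Rightarrow> real) \<times> (nat \<Rightarrow> real)) set"
  proof -
    have "compact (fst ` L)" using that by (intro compact_continuous_image continuous_intros)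
    then have "fst ` L \<in> sets borel" by (simp add: compact_imp_closed borel_closed)
    then have "i -` (fst ` L) \<inter> space N \<in> sets N" by (rule measurable_sets[OF i])
    then show ?thesis by (simp add: vimage_def Int_def conj_commute)
  qed
  have D: "D \<in> sets N" unfolding D_def by (rule hit[OF K])
  have spD: "space (restrict_space N D) = D" using D sets.sets_into_space by (auto simp: space_restrict_space)
  let ?G = "\<lambda>u. snd ` (K \<inter> {i u} \<times> UNIV)"
  obtain s where s: "s \<in> borel_measurable (restrict_space N D)"
    and sG: "\<And>u. u \<in> space (restrict_space N D) \<Longrightarrow> s u \<in> ?G u"
  proof (rule compact_valued_selection[of "restrict_space N D" ?G])
    fix u assume "u \<in> space (restrict_space N D)"
    then have "u \<in> D" by (simp only: spD)
    then show "?G u \<noteq> {}" unfolding D_def by force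
  next
    fix u
    have "compact (K \<inter> {i u} \<times> UNIV)"
      by (intro compact_Int_closed K closed_Times) auto
    then show "compact (?G u)" by (intro compact_continuous_image continuous_intros)
  next
    fix C :: "(nat \<Rightarrow> real) set" assume "closed C"
    then have "compact (K \<inter> UNIV \<times> C)" by (intro compact_Int_closed K closed_Times) auto
    from hit[OF this] have "D \<inter> {u \<in> space N. i u \<in> fst ` (K \<inter> UNIV \<times> C)} \<in> sets N"
      using D by (rule sets.Int[rotated])
    moreover have "{u \<in> space (restrict_space N D). ?G u \<inter> C \<noteq> {}}
        = D \<inter> {u \<in> space N. i u \<in> fst ` (K \<inter> UNIV \<times> C)}"
      unfolding spD by (auto simp: D_def image_iff) force+
    ultimately show "{u \<in> space (restrict_space N D). ?G u \<inter> C \<noteq> {}} \<in> sets (restrict_space N D)"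
      using D by (subst sets_restrict_space_iff) (auto dest: sets.sets_into_space)
  qed (auto simp: spD)
  show thesis
  proof (rule that[OF D s])
    fix u assume "u \<in> D"
    then have "s u \<in> ?G u" using sG spD by simp
    then show "(i u, s u) \<in> K" by auto
  qed
qed

text \<open>The set \<open>A\<close> is carried to the part over \<open>A\<close> of the graph of \<open>\<phi>\<close>, which is a Borel set in a Polish
  space. Inner regularity exhausts it by compact sets up to a null set, and each of these has
  a measurable section over its projection. Working with the graph instead of \<open>\<phi>\<close> makes the projection continuous.\<close>

lemma exhaustion_by_sections:
  fixes M :: "'a measure" and N :: "'b measure"
  assumes M: "standard_borel M" and N: "standard_borel N" and \<phi>: "\<phi> \<in> measurable M N"
    and A: "A \<in> sets M" "emeasure M A < \<infinity>"
  obtains K :: "nat \<Rightarrow> 'a set" and D :: "nat \<Rightarrow> 'b set" and s :: "nat \<Rightarrow> 'b \<Rightarrow> 'a"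
  where "\<And>k. K k \<in> sets M" "\<And>k. K k \<subseteq> A" "A - (\<Union>k. K k) \<in> null_sets M"
    "\<And>k. D k \<in> sets N" "\<And>k x. x \<in> K k \<Longrightarrow> \<phi> x \<in> D k"
    "\<And>k. s k \<in> measurable (restrict_space N (D k)) M"
    "\<And>k u. u \<in> D k \<Longrightarrow> s k u \<in> A \<and> \<phi> (s k u) = u"
proof -
  from standard_borel_embedding[OF M] obtain j :: "'a \<Rightarrow> nat \<Rightarrow> real" where
    j: "inj_on j (space M)" "j \<in> borel_measurable M" "\<And>A. A \<in> sets M \<Longrightarrow> j ` A \<in> sets borel" by blast
  from standard_borel_embedding[OF N] obtain i :: "'b \<Rightarrow> nat \<Rightarrow> real" where
    i: "inj_on i (space N)" "i \<in> borel_measurable N" by blast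
  define inv where "inv = inv_into (space M) j"
  have inv: "inv (j x) = x" if "x \<in> space M" for x
    unfolding inv_def using j(1) that by (rule inv_into_f_f)
  have AM: "A \<subseteq> space M" using A(1) by (rule sets.sets_into_space)
  have inv_meas: "inv \<in> measurable (restrict_space borel (j ` space M)) M"
  proof (rule measurableI)
    fix t assume "t \<in> space (restrict_space borel (j ` space M))"
    then show "inv t \<in> space M" by (auto simp: space_restrict_space inv)
  next
    fix B assume B: "B \<in> sets M"
    have "inv -` B \<inter> space (restrict_space borel (j ` space M)) = j ` B"
      using sets.sets_into_space[OF B] by (auto simp: space_restrict_space inv image_iff)
    then show "inv -` B \<inter> space (restrict_space borel (j ` space M)) \<in> sets (restrict_space borel (j ` space M))"
      using j(3)[OF B] j(3)[of "space M"] sets.sets_into_space[OF B]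
      by (subst sets_restrict_space_iff) auto
  qed
  define \<theta> where "\<theta> x = (i (\<phi> x), j x)" for x
  have \<theta>: "\<theta> \<in> borel_measurable M"
    unfolding \<theta>_def borel_prod[symmetric] using i(2) j(2) \<phi> by measurable
  \<comment> \<open>the graph of a Borel map over a Borel set is Borel\<close>
  have \<theta>A: "\<theta> ` A \<in> sets borel"
  proof -
    define h where "h t = (if t \<in> j ` space M then i (\<phi> (inv t)) else (\<lambda>_. 0))" for t
    have "h \<in> borel_measurable borel"
      unfolding h_def
    proof (rule measurable_If_restrict_space_iff[THEN iffD2])
      show "{x \<in> space borel. x \<in> j ` space M} \<in> sets borel"
        using j(3)[of "space M"] by simp
      show "(\<lambda>t. i (\<phi> (inv t))) \<in> borel_measurable (restrict_space borel {x. x \<in> j ` space M}) \<and>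
        (\<lambda>_ _. 0) \<in> borel_measurable (restrict_space borel {x. x \<notin> j ` space M})"
        using inv_meas \<phi> i(2) by (simp add: measurable_compose)
    qed
    then have "(\<lambda>p::(nat \<Rightarrow> real) \<times> (nat \<Rightarrow> real). (fst p, h (snd p))) \<in> borel_measurable borel"
      unfolding borel_prod[symmetric] by measurable
    moreover have "{p::(nat \<Rightarrow> real) \<times> (nat \<Rightarrow> real). fst p = snd p} \<in> sets borel"
      by (intro borel_closed closed_Collect_eq continuous_intros)
    ultimately have "(\<lambda>p. (fst p, h (snd p))) -` {p. fst p = snd p} \<inter> space borel
        \<in> sets (borel :: ((nat \<Rightarrow> real) \<times> (nat \<Rightarrow> real)) measure)"
      by (rule measurable_sets)
    moreover have "UNIV \<times> j ` A \<in> sets (borel :: ((nat \<Rightarrow> real) \<times> (nat \<Rightarrow> real)) measure)"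
      unfolding borel_prod[symmetric] using j(3)[OF A(1)] by (intro pair_measureI) auto
    ultimately have "((\<lambda>p. (fst p, h (snd p))) -` {p. fst p = snd p} \<inter> space borel) \<inter> (UNIV \<times> j ` A)
        \<in> sets (borel :: ((nat \<Rightarrow> real) \<times> (nat \<Rightarrow> real)) measure)"
      by (rule sets.Int)
    moreover have "((\<lambda>p. (fst p, h (snd p))) -` {p. fst p = snd p} \<inter> space borel) \<inter> (UNIV \<times> j ` A) = \<theta> ` A"
    proof -
      have "h (j x) = i (\<phi> x)" if "x \<in> A" for x
        using that AM by (auto simp: h_def inv subset_iff)
      then show ?thesis by (fastforce simp: \<theta>_def)
    qed
    ultimately show ?thesis by simp
  qed
  define P where "P = distr (density M (indicator A)) borel \<theta>"
  have \<theta>': "\<theta> \<in> measurable (density M (indicator A)) borel" using \<theta> by simp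
  have P: "emeasure P B = emeasure M (A \<inter> (\<theta> -` B \<inter> space M))" if "B \<in> sets borel" for B
    unfolding P_def using that A \<theta> by (simp add: emeasure_distr[OF \<theta>'] emeasure_restricted measurable_sets)
  have \<theta>inj: "x \<in> A" if "\<theta> x \<in> \<theta> ` A" "x \<in> space M" for x
    using that AM inv by (auto simp: \<theta>_def) (metis subsetD)
  have "emeasure P (\<theta> ` A) = emeasure M A"
    using AM by (subst P[OF \<theta>A]) (auto intro!: arg_cong[where f="emeasure M"])
  moreover have "emeasure P (\<theta> ` A) = (SUP K \<in> {K. K \<subseteq> \<theta> ` A \<and> compact K}. emeasure P K)"
  proof (rule inner_regular)
    have "emeasure P (space P) \<le> emeasure M A"
      using A by (simp add: P_def P[unfolded P_def] emeasure_mono)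
    then show "emeasure P (space P) \<noteq> \<infinity>" using A(2) by (auto simp: top_unique)
  qed (auto simp: P_def \<theta>A)
  ultimately have sup: "(SUP K \<in> {K. K \<subseteq> \<theta> ` A \<and> compact K}. emeasure P K) = emeasure M A" by simp
  have "emeasure P ` {K. K \<subseteq> \<theta> ` A \<and> compact K} \<noteq> {}" by auto
  from ennreal_Sup_countable_SUP[OF this] obtain f :: "nat \<Rightarrow> ennreal" where
    f: "range f \<subseteq> emeasure P ` {K. K \<subseteq> \<theta> ` A \<and> compact K}" "(SUP n. f n) = emeasure M A"
    using sup by auto
  have "\<exists>L. L \<subseteq> \<theta> ` A \<and> compact L \<and> f n = emeasure P L" for n
  proof -
    have "f n \<in> emeasure P ` {K. K \<subseteq> \<theta> ` A \<and> compact K}" using f(1) by (rule subsetD) simp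
    then show ?thesis by auto
  qed
  then obtain L where L: "\<And>n. L n \<subseteq> \<theta> ` A" "\<And>n. compact (L n)" "\<And>n. f n = emeasure P (L n)"
    by metis
  have Lb: "L n \<in> sets borel" for n using L(2) by (simp add: compact_imp_closed borel_closed)
  define K where "K n = \<theta> -` L n \<inter> space M" for n
  have KM: "K n \<in> sets M" for n unfolding K_def by (rule measurable_sets[OF \<theta> Lb])
  have KA: "K n \<subseteq> A" for n
  proof
    fix x assume "x \<in> K n"
    then have "\<theta> x \<in> L n" "x \<in> space M" by (simp_all add: K_def)
    then show "x \<in> A" using \<theta>inj[of x] subsetD[OF L(1)] by blast
  qed
  have fK: "f n = emeasure M (K n)" for n
    using KA[of n] L(3)[of n] P[OF Lb[of n]] by (simp add: K_def Int_absorb1 inf.absorb2)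
  have "emeasure M A \<le> emeasure M (\<Union>n. K n)"
    unfolding f(2)[symmetric] fK using KM by (intro SUP_least emeasure_mono) auto
  moreover have KAU: "(\<Union>n. K n) \<subseteq> A" using KA by blast
  moreover have "emeasure M (\<Union>n. K n) \<le> emeasure M A" using KAU A(1) by (rule emeasure_mono)
  moreover have "emeasure M (\<Union>n. K n) \<noteq> \<infinity>" using calculation A(2) by (auto simp: top_unique)
  ultimately have "emeasure M (A - (\<Union>n. K n)) = 0"
    using A KM by (subst emeasure_Diff) (auto simp: diff_eq_0_iff_ennreal less_top)
  then have null: "A - (\<Union>n. K n) \<in> null_sets M" using A KM by auto
  define D where "D n = {u \<in> space N. i u \<in> fst ` L n}" for n
  have "\<exists>s. D n \<in> sets N \<and> s \<in> borel_measurable (restrict_space N (D n)) \<and> (\<forall>u \<in> D n. (i u, s u) \<in> L n)" for n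
  proof -
    obtain s where "D n \<in> sets N" "s \<in> borel_measurable (restrict_space N (D n))"
      "\<And>u. u \<in> D n \<Longrightarrow> (i u, s u) \<in> L n"
      using compact_graph_section[OF i(2) L(2)[of n]] unfolding D_def by blast
    then show ?thesis by blast
  qed
  then have "\<forall>n. \<exists>s. D n \<in> sets N \<and> s \<in> borel_measurable (restrict_space N (D n))
      \<and> (\<forall>u \<in> D n. (i u, s u) \<in> L n)" by (rule allI)
  from choice[OF this] obtain s where s: "\<And>n. D n \<in> sets N"
    "\<And>n. s n \<in> borel_measurable (restrict_space N (D n))"
    "\<And>n u. u \<in> D n \<Longrightarrow> (i u, s n u) \<in> L n" by auto
  have sA: "inv (s n u) \<in> A \<and> \<phi> (inv (s n u)) = u \<and> s n u \<in> j ` space M" if u: "u \<in> D n" for n u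
  proof -
    obtain x where x: "x \<in> A" "i u = i (\<phi> x)" "s n u = j x"
      using subsetD[OF L(1) s(3)[OF u]] by (auto simp: \<theta>_def)
    have "x \<in> space M" using x AM by blast
    moreover have "\<phi> x = u"
      using i(1) x(2) u \<open>x \<in> space M\<close> measurable_space[OF \<phi>] by (auto simp: D_def inj_on_def)
    ultimately show ?thesis using x inv by auto
  qed
  show thesis
  proof (rule that[of K D "\<lambda>n u. inv (s n u)"])
    show "K n \<in> sets M" "K n \<subseteq> A" for n by (rule KM KA)+
    show "A - (\<Union>n. K n) \<in> null_sets M" by (rule null)
    show "D n \<in> sets N" for n by (rule s)
    show "\<phi> x \<in> D n" if "x \<in> K n" for n x
      using that measurable_space[OF \<phi>] by (force simp: K_def D_def \<theta>_def)
    show "inv (s n u) \<in> A \<and> \<phi> (inv (s n u)) = u" if "u \<in> D n" for n u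
      using sA[OF that] by simp
    show "(\<lambda>u. inv (s n u)) \<in> measurable (restrict_space N (D n)) M" for n
    proof (rule measurable_compose[OF _ inv_meas], rule measurable_restrict_space2)
      show "s n \<in> space (restrict_space N (D n)) \<rightarrow> j ` space M"
        using sA by (auto simp: space_restrict_space)
    qed (rule s)
  qed
qed

section \<open>Exhausting a space by pieces\<close>

definition exhausted :: "'a measure \<Rightarrow> 'a set \<Rightarrow> ('a set \<Rightarrow> bool) \<Rightarrow> bool" where
  "exhausted M A P \<longleftrightarrow>
     (\<exists>B :: nat \<Rightarrow> 'a set. (\<forall>n. B n \<in> sets M \<and> P (B n)) \<and> A - (\<Union>n. B n) \<in> null_sets M)"

lemma exhaustedI:
  assumes "A \<in> sets M" "countable I" "I \<noteq> {}" "\<And>i. i \<in> I \<Longrightarrow> B i \<in> sets M \<and> P (B i)"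
    and "Z \<in> null_sets M" "A - (\<Union>i\<in>I. B i) \<subseteq> Z"
  shows "exhausted M A P"
  unfolding exhausted_def
proof (intro exI conjI allI)
  let ?B = "\<lambda>n. B (from_nat_into I n)"
  show m: "?B n \<in> sets M" "P (?B n)" for n
    using assms(4)[OF from_nat_into[OF assms(3), of n]] by auto
  have "(\<Union>n. ?B n) = (\<Union>i\<in>range (from_nat_into I). B i)" by auto
  then have "(\<Union>n. ?B n) = (\<Union>i\<in>I. B i)" using range_from_nat_into[OF assms(3,2)] by simp
  then show "A - (\<Union>n. ?B n) \<in> null_sets M"
    using assms(1,6) m by (metis null_sets_subset[OF assms(5)] sets.Diff sets.countable_UN'' UNIV_I countableI_type)
qed

lemma exhausted_trans:
  assumes "A \<in> sets M" "exhausted M A P" "\<And>B. B \<in> sets M \<Longrightarrow> P B \<Longrightarrow> exhausted M B Q"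
  shows "exhausted M A Q"
proof -
  obtain B where B: "\<And>n::nat. B n \<in> sets M" "\<And>n. P (B n)" "A - (\<Union>n. B n) \<in> null_sets M"
    using assms(2) unfolding exhausted_def by blast
  have "\<forall>n. \<exists>C :: nat \<Rightarrow> 'a set. (\<forall>k. C k \<in> sets M \<and> Q (C k)) \<and> B n - (\<Union>k. C k) \<in> null_sets M"
    using assms(3)[OF B(1,2)] unfolding exhausted_def by (rule allI)
  from choice[OF this] obtain C where C: "\<And>n k::nat. C n k \<in> sets M \<and> Q (C n k)"
    "\<And>n. B n - (\<Union>k. C n k) \<in> null_sets M" by blast
  show ?thesis
  proof (rule exhaustedI[OF assms(1), of UNIV "\<lambda>i. C (fst i) (snd i)"])
    show "(A - (\<Union>n. B n)) \<union> (\<Union>n. B n - (\<Union>k. C n k)) \<in> null_sets M"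
      by (intro null_sets.Un B null_sets_UN C)
    show "A - (\<Union>i. C (fst i) (snd i)) \<subseteq> (A - (\<Union>n. B n)) \<union> (\<Union>n. B n - (\<Union>k. C n k))"
      by auto
  qed (use C in auto)
qed

text \<open>On a set \<open>X\<close> of finite measure the push-forward is finite and has a density with respect to \<open>N\<close>,
  which is finite almost everywhere. The pieces are the parts of \<open>X\<close> lying over the sets where
  the density is at most \<open>k\<close>.\<close>

lemma exhausted_dominated:
  assumes M: "sigma_finite_measure M" and N: "sigma_finite_measure N" and \<phi>: "nonsingular_map M N \<phi>"
  shows "exhausted M (space M) (\<lambda>A. emeasure M A < \<infinity> \<and> (\<exists>C. dominated_on M N \<phi> C A))"
proof (rule exhausted_trans)
  interpret M: sigma_finite_measure M by (rule M)
  obtain X where X: "range X \<subseteq> sets M" "(\<Union>i. X i) = space M" "\<And>i::nat. emeasure M (X i) \<noteq> \<infinity>"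
    using M.sigma_finite by blast
  show "exhausted M (space M) (\<lambda>A. emeasure M A < \<infinity>)"
    unfolding exhausted_def using X by (intro exI[of _ X]) (auto simp: less_top)
next
  interpret N: sigma_finite_measure N by (rule N)
  have m[measurable]: "\<phi> \<in> measurable M N" using \<phi> by (simp add: nonsingular_map_def)
  fix X assume X[measurable]: "X \<in> sets M" and fin: "emeasure M X < \<infinity>"
  define P where "P = distr (density M (indicator X)) N \<phi>"
  have P: "(\<integral>\<^sup>+u. g u \<partial>P) = (\<integral>\<^sup>+x. indicator X x * g (\<phi> x) \<partial>M)" if [measurable]: "g \<in> borel_measurable N" for g
    unfolding P_def by (subst nn_integral_distr) (auto simp: nn_integral_density)
  have "absolutely_continuous N P"
    unfolding absolutely_continuous_def
  proof
    fix A assume A: "A \<in> null_sets N"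
    then have "\<phi> -` A \<inter> space M \<in> null_sets M" using \<phi> by (auto simp: nonsingular_map_def)
    then have "emeasure M (X \<inter> (\<phi> -` A \<inter> space M)) = 0"
      using X by (metis Int_commute emeasure_eq_0 inf_le1 null_setsD1 null_setsD2)
    then show "A \<in> null_sets P"
      using A by (auto simp: P_def null_sets_def emeasure_distr emeasure_restricted measurable_sets)
  qed
  moreover have "sets P = sets N" by (simp add: P_def)
  ultimately obtain h where h[measurable]: "h \<in> borel_measurable N" and hP: "density N h = P"
    using N.Radon_Nikodym by blast
  have "(\<integral>\<^sup>+u. h u \<partial>N) = (\<integral>\<^sup>+u. 1 \<partial>P)"
    unfolding hP[symmetric] by (subst nn_integral_density) auto
  also have "\<dots> = emeasure M X" by (subst P) auto
  finally have "AE u in N. h u \<noteq> \<infinity>" using fin by (intro nn_integral_PInf_AE) auto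
  then have "{u \<in> space N. h u = \<infinity>} \<in> null_sets N"
    by (subst (asm) AE_iff_null) auto
  then have null: "\<phi> -` {u \<in> space N. h u = \<infinity>} \<inter> space M \<in> null_sets M"
    using \<phi> by (auto simp: nonsingular_map_def)
  define B where "B k = X \<inter> (\<phi> -` {u \<in> space N. h u \<le> of_nat k} \<inter> space M)" for k :: nat
  show "exhausted M X (\<lambda>A. emeasure M A < \<infinity> \<and> (\<exists>C. dominated_on M N \<phi> C A))"
  proof (rule exhaustedI[OF X _ _ _ null, of UNIV B])
    fix k
    have Bm[measurable]: "B k \<in> sets M" unfolding B_def by measurable
    moreover have "emeasure M (B k) \<le> emeasure M X" by (rule emeasure_mono) (auto simp: B_def)
    then have "emeasure M (B k) < \<infinity>" using fin by (rule le_less_trans)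
    moreover have "dominated_on M N \<phi> (real k) (B k)"
      unfolding dominated_on_def
    proof (intro conjI ballI Bm)
      fix g :: "'b \<Rightarrow> ennreal" assume g[measurable]: "g \<in> borel_measurable N"
      let ?H = "{u \<in> space N. h u \<le> of_nat k}"
      have "(\<integral>\<^sup>+x. indicator (B k) x * g (\<phi> x) \<partial>M) = (\<integral>\<^sup>+x. indicator X x * (indicator ?H (\<phi> x) * g (\<phi> x)) \<partial>M)"
        using measurable_space[OF m] by (intro nn_integral_cong) (auto simp: B_def indicator_def)
      also have "\<dots> = (\<integral>\<^sup>+u. indicator ?H u * g u \<partial>P)" by (rule P[symmetric]) measurable
      also have "\<dots> = (\<integral>\<^sup>+u. h u * (indicator ?H u * g u) \<partial>N)"
        unfolding hP[symmetric] by (rule nn_integral_density) measurable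
      also have "\<dots> \<le> (\<integral>\<^sup>+u. of_nat k * g u \<partial>N)"
        by (intro nn_integral_mono) (auto simp: indicator_def intro!: mult_right_mono)
      also have "\<dots> = of_nat k * (\<integral>\<^sup>+u. g u \<partial>N)" by (rule nn_integral_cmult) measurable
      finally show "(\<integral>\<^sup>+x. indicator (B k) x * g (\<phi> x) \<partial>M) \<le> ennreal (real k) * (\<integral>\<^sup>+u. g u \<partial>N)"
        by (simp add: ennreal_of_nat_eq_real_of_nat)
    qed
    ultimately show "B k \<in> sets M \<and> emeasure M (B k) < \<infinity> \<and> (\<exists>C. dominated_on M N \<phi> C (B k))" by blast
  next
    have "\<exists>k. h u \<le> of_nat k" if "h u \<noteq> \<infinity>" for u
      using that by (metis ennreal_Ex_less_of_nat infinity_ennreal_def less_imp_le top.not_eq_extremum)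
    then show "X - (\<Union>k. B k) \<subseteq> \<phi> -` {u \<in> space N. h u = \<infinity>} \<inter> space M"
      using sets.sets_into_space[OF X] measurable_space[OF m] by (auto simp: B_def subset_iff)
  qed auto
qed auto

definition zero_extension :: "complex list \<Rightarrow> nat \<Rightarrow> complex" where
  "zero_extension xs n = (if n < length xs then xs ! n else 0)"

text \<open>Separability of \<open>\<ell>\<^sup>2\<close>: cut off a small tail, and approximate the remaining entries from \<open>S\<close>.\<close>

lemma sqsum_zero_extension_dense:
  fixes S :: "complex set"
  assumes S: "\<And>X. open X \<Longrightarrow> X \<noteq> {} \<Longrightarrow> \<exists>d \<in> S. d \<in> X"
    and a: "sqsum a < \<infinity>" and e: "e > 0"
  shows "\<exists>xs \<in> lists S. sqsum (\<lambda>n. a n - zero_extension xs n) \<le> ennreal e"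
proof -
  have sm: "summable (\<lambda>n. (cmod (a n))\<^sup>2)" by (rule sqsum_summable[OF a])
  obtain m where "\<forall>n\<ge>m. norm (\<Sum>i. (cmod (a (i + n)))\<^sup>2) < e / 2"
    using suminf_exist_split[OF _ sm, of "e/2"] e by auto
  then have m: "(\<Sum>i. (cmod (a (i + m)))\<^sup>2) < e / 2" by (auto simp: abs_less_iff)
  define r where "r = sqrt (e / (2 * (real m + 1)))"
  have r: "r > 0" "r\<^sup>2 = e / (2 * (real m + 1))" using e by (auto simp: r_def)
  have "\<exists>d \<in> S. dist (a n) d < r" for n
    using S[of "ball (a n) r"] r(1) by auto
  then obtain q where q: "\<And>n. q n \<in> S" "\<And>n. dist (a n) (q n) < r" by metis
  define xs where "xs = map q [0..<m]"
  have pad: "zero_extension xs n = (if n < m then q n else 0)" for n by (simp add: zero_extension_def xs_def)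
  let ?b = "\<lambda>n. (cmod (a n - zero_extension xs n))\<^sup>2"
  have shift: "?b (i + m) = (cmod (a (i + m)))\<^sup>2" for i by (simp add: pad)
  have smb: "summable ?b"
    using sm summable_iff_shift[of "\<lambda>n. (cmod (a n))\<^sup>2" m] summable_iff_shift[of ?b m] by (simp only: shift)
  have "(\<Sum>n. ?b n) = (\<Sum>i. ?b (i + m)) + (\<Sum>i<m. ?b i)"
    by (rule suminf_split_initial_segment[OF smb])
  also have "(\<Sum>i<m. ?b i) \<le> (\<Sum>i<m. r\<^sup>2)"
  proof (rule sum_mono)
    fix i assume "i \<in> {..<m}"
    then show "?b i \<le> r\<^sup>2" using q(2)[of i] by (auto simp: pad dist_norm intro!: power_mono)
  qed
  also have "(\<Sum>i<m. r\<^sup>2) \<le> e / 2" using e by (simp add: r(2) field_simps)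
  finally have "(\<Sum>n. ?b n) \<le> e" using m by (simp add: shift)
  moreover have "sqsum (\<lambda>n. a n - zero_extension xs n) = ennreal (\<Sum>n. ?b n)"
    unfolding sqsum_def by (rule suminf_ennreal2) (use smb in auto)
  ultimately have "sqsum (\<lambda>n. a n - zero_extension xs n) \<le> ennreal e" by (simp add: ennreal_leI)
  moreover have "xs \<in> lists S" using q(1) by (auto simp: xs_def)
  ultimately show ?thesis by blast
qed

text \<open>Sort the points by the finitely supported sequence, out of countably many, to which \<open>f x\<close> is
  close, and by a lower bound of the tolerance \<open>w x\<close>. On each piece \<open>f\<close> stays close to a fixed
  sequence, so it is bounded there too.\<close>

lemma exhausted_small_oscillation:
  assumes f: "\<And>n. f n \<in> borel_measurable M" and Z: "Z \<in> null_sets M"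
    and fin: "\<And>x. x \<in> space M - Z \<Longrightarrow> sqsum (\<lambda>n. f n x) < \<infinity>"
    and w: "w \<in> borel_measurable M" "\<And>x. x \<in> space M \<Longrightarrow> 0 < w x"
    and A: "A \<in> sets M"
  shows "exhausted M A (\<lambda>B. B \<subseteq> A - Z \<and> (\<exists>R::real. \<forall>x \<in> B. sqsum (\<lambda>n. f n x) \<le> ennreal R) \<and>
      (\<forall>x \<in> B. \<forall>x' \<in> B. sqsum (\<lambda>n. f n x - f n x') \<le> ennreal (w x)))"
proof -
  note [measurable] = f w(1) A
  have Zm[measurable]: "Z \<in> sets M" using Z by auto
  obtain S :: "complex set" where S: "countable S" "\<And>X. open X \<Longrightarrow> X \<noteq> {} \<Longrightarrow> \<exists>d \<in> S. d \<in> X"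
    using countable_dense_exists by blast
  define B where "B = (\<lambda>(k::nat, xs). {x \<in> space M. x \<in> A - Z \<and> 1 / (real k + 1) \<le> w x \<and>
      sqsum (\<lambda>n. f n x - zero_extension xs n) \<le> ennreal (1 / (4 * (real k + 1)))})"
  show ?thesis
  proof (rule exhaustedI[OF A _ _ _ Z, of "UNIV \<times> lists S" B])
    show "countable ((UNIV :: nat set) \<times> lists S)" using S(1) by (intro countable_SIGMA countable_lists) auto
    show "(UNIV :: nat set) \<times> lists S \<noteq> {}" by auto
    fix i assume i: "i \<in> (UNIV :: nat set) \<times> lists S"
    then obtain k xs where ik: "i = (k, xs)" by force
    have Bm: "B i \<in> sets M" unfolding B_def ik by simp
    have BA: "B i \<subseteq> A - Z" by (auto simp: B_def ik)
    have close: "sqsum (\<lambda>n. f n x - zero_extension xs n) \<le> ennreal (1 / (4 * (real k + 1)))" if "x \<in> B i" for x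
      using that by (simp add: B_def ik)
    have "sqsum (zero_extension xs) = (\<Sum>n<length xs. ennreal ((cmod (zero_extension xs n))\<^sup>2))"
      unfolding sqsum_def by (rule suminf_finite) (auto simp: zero_extension_def)
    then have padfin: "sqsum (zero_extension xs) < \<infinity>" by simp
    have "\<exists>R::real. \<forall>x \<in> B i. sqsum (\<lambda>n. f n x) \<le> ennreal R"
    proof (intro exI ballI)
      let ?T = "2 * ennreal (1 / (4 * (real k + 1))) + 2 * sqsum (zero_extension xs)"
      fix x assume "x \<in> B i"
      have "sqsum (\<lambda>n. f n x) \<le> 2 * sqsum (\<lambda>n. f n x - zero_extension xs n) + 2 * sqsum (zero_extension xs)"
        using sqsum_add_le[of "\<lambda>n. f n x - zero_extension xs n" "zero_extension xs"] by simp
      also have "\<dots> \<le> ?T" using close[OF \<open>x \<in> B i\<close>] by (intro add_mono mult_left_mono) auto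
      also have "\<dots> = ennreal (enn2real ?T)"
      proof -
        have "?T < top" using padfin by (auto simp: ennreal_mult_less_top)
        then show ?thesis by simp
      qed
      finally show "sqsum (\<lambda>n. f n x) \<le> ennreal (enn2real ?T)" .
    qed
    moreover have "sqsum (\<lambda>n. f n x - f n x') \<le> ennreal (w x)" if "x \<in> B i" "x' \<in> B i" for x x'
    proof -
      have "sqsum (\<lambda>n. f n x - f n x') \<le> 2 * sqsum (\<lambda>n. f n x - zero_extension xs n) + 2 * sqsum (\<lambda>n. f n x' - zero_extension xs n)"
        using sqsum_diff_le[of "\<lambda>n. f n x - zero_extension xs n" "\<lambda>n. f n x' - zero_extension xs n"] by simp
      also have "\<dots> \<le> 2 * ennreal (1 / (4 * (real k + 1))) + 2 * ennreal (1 / (4 * (real k + 1)))"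
        by (intro add_mono mult_left_mono close that) auto
      also have "\<dots> = ennreal (1 / (real k + 1))"
      proof -
        have "2 * ennreal c + 2 * ennreal c = ennreal (4 * c)" if "c \<ge> 0" for c
        proof -
          have "2 * ennreal c = ennreal (2 * c)" using that by (simp add: ennreal_mult)
          then show ?thesis using that by (simp flip: ennreal_plus)
        qed
        from this[of "1 / (4 * (real k + 1))"]
        have "2 * ennreal (1 / (4 * (real k + 1))) + 2 * ennreal (1 / (4 * (real k + 1)))
            = ennreal (4 * (1 / (4 * (real k + 1))))" by simp
        moreover have "4 * (1 / (4 * y)) = 1 / y" for y :: real by simp
        ultimately show ?thesis by (simp only:)
      qed
      also have "\<dots> \<le> ennreal (w x)" using that(1) by (intro ennreal_leI) (simp add: B_def ik)
      finally show ?thesis .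
    qed
    ultimately show "B i \<in> sets M \<and> B i \<subseteq> A - Z \<and> (\<exists>R::real. \<forall>x \<in> B i. sqsum (\<lambda>n. f n x) \<le> ennreal R) \<and>
      (\<forall>x \<in> B i. \<forall>x' \<in> B i. sqsum (\<lambda>n. f n x - f n x') \<le> ennreal (w x))"
      using Bm BA by blast
  next
    show "A - (\<Union>i \<in> UNIV \<times> lists S. B i) \<subseteq> Z"
    proof (rule subsetI, rule ccontr)
      fix x assume x: "x \<in> A - (\<Union>i \<in> UNIV \<times> lists S. B i)" and xZ: "x \<notin> Z"
      have xM: "x \<in> space M" using x sets.sets_into_space[OF A] by blast
      obtain k where k: "inverse (real (Suc k)) < w x"
        using reals_Archimedean[OF w(2)[OF xM]] by blast
      obtain xs where "xs \<in> lists S" "sqsum (\<lambda>n. f n x - zero_extension xs n) \<le> ennreal (1 / (4 * (real k + 1)))"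
        using sqsum_zero_extension_dense[OF S(2) fin[of x], of "1 / (4 * (real k + 1))"] xM xZ by auto
      then have "x \<in> B (k, xs)"
        using x xM xZ k by (auto simp: B_def inverse_eq_divide add.commute)
      then show False using x \<open>xs \<in> lists S\<close> by blast
    qed
  qed
qed

text \<open>The last condition is what transfers pointwise vanishing of \<open>F\<close> to the coefficients of its
  approximation: \<open>a\<close> takes actual values of \<open>f\<close> on the fibre, not averages of them. The zero
  sequence is the value where the section behind \<open>a\<close> is undefined, and \<open>Z\<close> is the null set where
  \<open>f\<close> carries no information about \<open>F\<close>.\<close>

definition fibrewise_approximation ::
    "'a measure \<Rightarrow> 'b measure \<Rightarrow> ('a \<Rightarrow> 'b) \<Rightarrow> 'a set \<Rightarrow> (nat \<Rightarrow> 'a \<Rightarrow> complex) \<Rightarrow>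
     ('a \<Rightarrow> real) \<Rightarrow> 'a set \<Rightarrow> real \<Rightarrow> (nat \<Rightarrow> 'b \<Rightarrow> complex) \<Rightarrow> bool" where
  "fibrewise_approximation M N \<phi> Z f w A C a \<longleftrightarrow>
     dominated_on M N \<phi> C A \<and> (\<forall>n. a n \<in> borel_measurable N) \<and> energy N a < \<infinity> \<and>
     (\<forall>x \<in> A. sqsum (\<lambda>n. f n x - a n (\<phi> x)) \<le> ennreal (w x)) \<and>
     (\<forall>u \<in> space N. (\<forall>n. a n u = 0) \<or> (\<exists>x \<in> space M - Z. \<phi> x = u \<and> (\<forall>n. a n u = f n x)))"

text \<open>Refine the space successively: to pieces dominated by \<open>N\<close>, lying over a set of finite measure, with
  small oscillation of \<open>f\<close>. For such a piece \<open>E\<close> take \<open>a = f \<circ> s\<close> for a section \<open>s\<close> with values in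
  \<open>E\<close>. A point of \<open>E\<close> and the point that \<open>s\<close> selects on its fibre both lie in \<open>E\<close>, so the
  error is at most the oscillation. The energy of \<open>a\<close> is finite since \<open>a\<close> is bounded and
  lives on a set of finite measure.\<close>

lemma exhausted_fibrewise_approximation:
  fixes M :: "'a measure" and N :: "'b measure" and f :: "nat \<Rightarrow> 'a \<Rightarrow> complex"
  assumes M: "standard_borel M" "sigma_finite_measure M" and N: "standard_borel N" "sigma_finite_measure N"
    and \<phi>: "nonsingular_map M N \<phi>"
    and f: "\<And>n. f n \<in> borel_measurable M" and Z: "Z \<in> null_sets M"
    and fin: "\<And>x. x \<in> space M - Z \<Longrightarrow> sqsum (\<lambda>n. f n x) < \<infinity>"
    and w: "w \<in> borel_measurable M" "\<And>x. x \<in> space M \<Longrightarrow> 0 < w x"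
  shows "exhausted M (space M) (\<lambda>A. \<exists>C a. fibrewise_approximation M N \<phi> Z f w A C a)"
proof (rule exhausted_trans[OF _ exhausted_dominated[OF M(2) N(2) \<phi>]])
  have \<phi>m[measurable]: "\<phi> \<in> measurable M N" using \<phi> by (simp add: nonsingular_map_def)
  fix A assume A[measurable]: "A \<in> sets M" and "emeasure M A < \<infinity> \<and> (\<exists>C. dominated_on M N \<phi> C A)"
  then obtain C where Af: "emeasure M A < \<infinity>" and C: "dominated_on M N \<phi> C A" by blast
  interpret N: sigma_finite_measure N by (rule N)
  obtain Q where Q: "range Q \<subseteq> sets N" "(\<Union>i. Q i) = space N" "\<And>i::nat. emeasure N (Q i) \<noteq> \<infinity>"
    using N.sigma_finite by blast
  show "exhausted M A (\<lambda>A. \<exists>C a. fibrewise_approximation M N \<phi> Z f w A C a)"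
  proof (rule exhausted_trans[OF A])
    show "exhausted M A (\<lambda>B. B \<subseteq> A \<and> (\<exists>V \<in> sets N. emeasure N V < \<infinity> \<and> \<phi> ` B \<subseteq> V))"
    proof (rule exhaustedI[OF A, of UNIV "\<lambda>i. A \<inter> (\<phi> -` Q i \<inter> space M)" _ "{}"])
      show "A - (\<Union>i. A \<inter> (\<phi> -` Q i \<inter> space M)) \<subseteq> {}"
      proof
        fix x assume x: "x \<in> A - (\<Union>i. A \<inter> (\<phi> -` Q i \<inter> space M))"
        then have "x \<in> space M" using sets.sets_into_space[OF A] by blast
        then have "\<phi> x \<in> (\<Union>i. Q i)" unfolding Q(2) by (rule measurable_space[OF \<phi>m])
        then show "x \<in> {}" using x \<open>x \<in> space M\<close> by auto
      qed
      fix i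
      have "Q i \<in> sets N" using Q(1) by auto
      then show "A \<inter> (\<phi> -` Q i \<inter> space M) \<in> sets M \<and> A \<inter> (\<phi> -` Q i \<inter> space M) \<subseteq> A \<and>
         (\<exists>V\<in>sets N. emeasure N V < \<infinity> \<and> \<phi> ` (A \<inter> (\<phi> -` Q i \<inter> space M)) \<subseteq> V)"
        using Q(3)[of i] by (auto simp: less_top intro!: bexI[of _ "Q i"])
    qed auto
  next
    fix B assume B: "B \<in> sets M" and "B \<subseteq> A \<and> (\<exists>V \<in> sets N. emeasure N V < \<infinity> \<and> \<phi> ` B \<subseteq> V)"
    then obtain V where BA: "B \<subseteq> A" and V: "V \<in> sets N" "emeasure N V < \<infinity>" "\<phi> ` B \<subseteq> V" by blast
    show "exhausted M B (\<lambda>A. \<exists>C a. fibrewise_approximation M N \<phi> Z f w A C a)"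
    proof (rule exhausted_trans[OF B exhausted_small_oscillation[OF f Z fin w B]])
      fix E assume E: "E \<in> sets M" and "E \<subseteq> B - Z \<and> (\<exists>R::real. \<forall>x \<in> E. sqsum (\<lambda>n. f n x) \<le> ennreal R) \<and>
        (\<forall>x \<in> E. \<forall>x' \<in> E. sqsum (\<lambda>n. f n x - f n x') \<le> ennreal (w x))"
      then obtain R :: real where EB: "E \<subseteq> B - Z" and R: "\<And>x. x \<in> E \<Longrightarrow> sqsum (\<lambda>n. f n x) \<le> ennreal R"
        and osc: "\<And>x x'. x \<in> E \<Longrightarrow> x' \<in> E \<Longrightarrow> sqsum (\<lambda>n. f n x - f n x') \<le> ennreal (w x)" by blast
      have "emeasure M E \<le> emeasure M A" using EB BA by (intro emeasure_mono A) blast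
      then have "emeasure M E < \<infinity>" using Af by (rule le_less_trans)
      from exhaustion_by_sections[OF M(1) N(1) \<phi>m E this]
      obtain K D s where K: "\<And>k::nat. K k \<in> sets M" "\<And>k. K k \<subseteq> E" "E - (\<Union>k. K k) \<in> null_sets M"
        and D: "\<And>k. D k \<in> sets N" "\<And>k x. x \<in> K k \<Longrightarrow> \<phi> x \<in> D k"
        and s: "\<And>k. s k \<in> measurable (restrict_space N (D k)) M"
          "\<And>k u. u \<in> D k \<Longrightarrow> s k u \<in> E \<and> \<phi> (s k u) = u" by metis
      show "exhausted M E (\<lambda>A. \<exists>C a. fibrewise_approximation M N \<phi> Z f w A C a)"
        unfolding exhausted_def
      proof (intro exI[of _ K] conjI allI)
        fix k
        define a where "a n u = (if u \<in> D k then f n (s k u) else 0)" for n u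
        have am: "a n \<in> borel_measurable N" for n
          unfolding a_def
        proof (rule measurable_If_restrict_space_iff[THEN iffD2])
          show "{x \<in> space N. x \<in> D k} \<in> sets N" using D(1)[of k] by simp
          show "(\<lambda>u. f n (s k u)) \<in> borel_measurable (restrict_space N {u. u \<in> D k}) \<and>
              (\<lambda>_. 0) \<in> borel_measurable (restrict_space N {u. u \<notin> D k})"
            using s(1)[of k] f[of n] by (simp add: measurable_compose)
        qed
        have DV: "D k \<subseteq> V"
        proof
          fix u assume "u \<in> D k"
          then have "s k u \<in> B" "\<phi> (s k u) = u" using s(2)[OF \<open>u \<in> D k\<close>] EB by auto
          then show "u \<in> V" using V(3) by (metis image_subset_iff)
        qed
        have "sqsum (\<lambda>n. a n u) \<le> ennreal R * indicator V u" for u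
        proof (cases "u \<in> D k")
          case True
          then show ?thesis using R[of "s k u"] s(2)[OF True] DV by (auto simp: a_def)
        qed (simp add: a_def sqsum_def)
        then have "energy N a \<le> (\<integral>\<^sup>+u. ennreal R * indicator V u \<partial>N)"
          unfolding energy_def by (intro nn_integral_mono)
        also have "\<dots> = ennreal R * emeasure N V" using V(1) by (simp add: nn_integral_cmult_indicator)
        also have "\<dots> < \<infinity>" using V(2) by (simp add: ennreal_mult_less_top)
        finally have ae: "energy N a < \<infinity>" .
        have "K k \<subseteq> A" using K(2)[of k] EB BA by blast
        then have "dominated_on M N \<phi> C (K k)" by (rule dominated_on_subset[OF C _ K(1)])
        moreover have "sqsum (\<lambda>n. f n x - a n (\<phi> x)) \<le> ennreal (w x)" if "x \<in> K k" for x
          using osc[of x "s k (\<phi> x)"] that K(2)[of k] D(2)[OF that] s(2)[OF D(2)[OF that]]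
          by (auto simp: a_def)
        moreover have "(\<forall>n. a n u = 0) \<or> (\<exists>x \<in> space M - Z. \<phi> x = u \<and> (\<forall>n. a n u = f n x))" for u
        proof (cases "u \<in> D k")
          case True
          then have "s k u \<in> space M - Z" using s(2)[OF True] EB sets.sets_into_space[OF E] by blast
          then show ?thesis using s(2)[OF True] True by (auto simp: a_def)
        qed (simp add: a_def)
        ultimately have "fibrewise_approximation M N \<phi> Z f w (K k) C a"
          unfolding fibrewise_approximation_def using am ae by blast
        then show "\<exists>C a. fibrewise_approximation M N \<phi> Z f w (K k) C a" by blast
      qed (use K in auto)
    qed
  qed
qed auto

section \<open>Approximation by finitely many pieces\<close>

text \<open>The global form of \<open>fibrewise_approximation\<close>: the pointwise tolerance is replaced by a bound
  on the total energy of the error, which includes the energy of \<open>f\<close> outside the first \<open>m\<close> pieces.\<close>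

definition finite_fibrewise_approximation ::
    "'a measure \<Rightarrow> 'b measure \<Rightarrow> ('a \<Rightarrow> 'b) \<Rightarrow> 'a set \<Rightarrow> (nat \<Rightarrow> 'a \<Rightarrow> complex) \<Rightarrow>
     real \<Rightarrow> nat \<Rightarrow> (nat \<Rightarrow> 'a set) \<Rightarrow> (nat \<Rightarrow> nat \<Rightarrow> 'b \<Rightarrow> complex) \<Rightarrow> bool" where
  "finite_fibrewise_approximation M N \<phi> Z f e m A a \<longleftrightarrow>
     (\<forall>j. \<exists>C. dominated_on M N \<phi> C (A j)) \<and> (\<forall>j n. a j n \<in> borel_measurable N) \<and>
     (\<forall>j. energy N (a j) < \<infinity>) \<and>
     (\<forall>j. \<forall>u \<in> space N. (\<forall>n. a j n u = 0) \<or> (\<exists>x \<in> space M - Z. \<phi> x = u \<and> (\<forall>n. a j n u = f n x))) \<and>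
     energy M (\<lambda>n x. f n x - (\<Sum>j<m. indicator (A j) x * a j n (\<phi> x))) \<le> ennreal e"

text \<open>The tolerance is chosen integrable with integral at most \<open>e / 2\<close>, which is possible on a
  \<open>\<sigma>\<close>-finite space. After making the pieces disjoint, the total error is at most the tolerance on the first
  \<open>m\<close> pieces and the energy of \<open>f\<close> on the rest, which tends to zero as \<open>m\<close> grows.\<close>

lemma ex_finite_fibrewise_approximation:
  fixes M :: "'a measure" and N :: "'b measure" and f :: "nat \<Rightarrow> 'a \<Rightarrow> complex"
  assumes M: "standard_borel M" "sigma_finite_measure M" and N: "standard_borel N" "sigma_finite_measure N"
    and \<phi>: "nonsingular_map M N \<phi>"
    and f: "\<And>n. f n \<in> borel_measurable M" and Z: "Z \<in> null_sets M"
    and fin: "\<And>x. x \<in> space M - Z \<Longrightarrow> sqsum (\<lambda>n. f n x) < \<infinity>"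
    and ef: "energy M f < \<infinity>" and e: "e > 0"
  shows "\<exists>m A a. finite_fibrewise_approximation M N \<phi> Z f e m A a"
proof -
  note [measurable] = f
  have \<phi>m[measurable]: "\<phi> \<in> measurable M N" using \<phi> by (simp add: nonsingular_map_def)
  interpret M: sigma_finite_measure M by (rule M)
  obtain v :: "'a \<Rightarrow> real" where v: "v \<in> borel_measurable M" "\<And>x. v x > 0" "integrable M v"
    using M.obtain_positive_integrable_function by metis
  define c where "c = e / (2 * ((LINT x|M. v x) + 1))"
  have I: "(LINT x|M. v x) \<ge> 0" using v(2) by (intro integral_nonneg_AE) (auto intro: less_imp_le)
  then have c: "c > 0" using e by (simp add: c_def)
  define w where "w x = c * v x" for x
  have wm[measurable]: "w \<in> borel_measurable M" unfolding w_def[abs_def] using v(1) by simp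
  have wpos: "w x > 0" for x using c v(2) by (simp add: w_def)
  have "(\<integral>\<^sup>+x. ennreal (w x) \<partial>M) = ennreal (LINT x|M. w x)"
    using wpos v(3) by (intro nn_integral_eq_integral) (auto simp: w_def[abs_def] less_imp_le)
  also have "(LINT x|M. w x) \<le> e / 2"
    unfolding w_def[abs_def] using I e by (simp add: c_def field_simps)
  finally have wint: "(\<integral>\<^sup>+x. ennreal (w x) \<partial>M) \<le> ennreal (e / 2)" by (simp add: ennreal_leI)
  have "exhausted M (space M) (\<lambda>A. \<exists>C a. fibrewise_approximation M N \<phi> Z f w A C a)"
    by (rule exhausted_fibrewise_approximation[OF M N \<phi> f Z fin wm wpos])
  then obtain B where B: "\<And>i::nat. B i \<in> sets M" "space M - (\<Union>i. B i) \<in> null_sets M"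
    and "\<forall>i. \<exists>Ca. fibrewise_approximation M N \<phi> Z f w (B i) (fst Ca) (snd Ca)"
    unfolding exhausted_def by auto
  from choice[OF this(3)] obtain Ca where "\<And>i. fibrewise_approximation M N \<phi> Z f w (B i) (fst (Ca i)) (snd (Ca i))"
    by blast
  then obtain C a where Ba: "\<And>i. fibrewise_approximation M N \<phi> Z f w (B i) (C i) (a i)"
    by (rule that[of "\<lambda>i. fst (Ca i)" "\<lambda>i. snd (Ca i)"])
  define A where "A = disjointed B"
  have AB: "A i \<subseteq> B i" for i by (simp add: A_def disjointed_subset)
  have Am[measurable]: "A i \<in> sets M" for i
    using sets.range_disjointed_sets[of B M] B(1) by (auto simp: A_def)
  have disj: "disjoint_family A" unfolding A_def by (rule disjoint_family_disjointed)
  have UA: "(\<Union>i. A i) = (\<Union>i. B i)" unfolding A_def by (rule UN_disjointed_eq)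
  define R where "R m = space M - (\<Union>j<m. A j)" for m
  have Rm[measurable]: "R m \<in> sets M" for m unfolding R_def by measurable
  \<comment> \<open>the part of the space left over by the first \<open>m\<close> pieces carries little energy\<close>
  have "(\<lambda>m. \<integral>\<^sup>+x\<in>R m. sqsum (\<lambda>n. f n x) \<partial>M) \<longlonglongrightarrow> 0"
  proof -
    let ?D = "density M (\<lambda>x. sqsum (\<lambda>n. f n x))"
    have D: "emeasure ?D S = (\<integral>\<^sup>+x\<in>S. sqsum (\<lambda>n. f n x) \<partial>M)" if "S \<in> sets M" for S
      using that by (intro emeasure_density) measurable
    have "(\<lambda>m. emeasure ?D (R m)) \<longlonglongrightarrow> emeasure ?D (\<Inter>m. R m)"
    proof (rule Lim_emeasure_decseq)
      show "range R \<subseteq> sets ?D" by auto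
      show "decseq R" by (auto simp: decseq_def R_def)
      fix m
      have "emeasure ?D (R m) \<le> energy M f"
        unfolding D[OF Rm] energy_def by (intro nn_integral_mono) (auto simp: indicator_def)
      then show "emeasure ?D (R m) \<noteq> \<infinity>" using ef by (auto simp: top_unique)
    qed
    moreover have "(\<Inter>m. R m) = space M - (\<Union>i. B i)"
      unfolding UA[symmetric] by (auto simp: R_def)
    moreover have "emeasure ?D (space M - (\<Union>i. B i)) = 0"
      using B(2) D[of "space M - (\<Union>i. B i)"] by (simp add: null_sets_def nn_integral_null_set null_setsI)
    ultimately show ?thesis by (simp add: D)
  qed
  then have "eventually (\<lambda>m. (\<integral>\<^sup>+x\<in>R m. sqsum (\<lambda>n. f n x) \<partial>M) < ennreal (e / 2)) sequentially"
    using e by (intro order_tendstoD(2)[where y=0]) auto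
  then obtain m where m: "(\<integral>\<^sup>+x\<in>R m. sqsum (\<lambda>n. f n x) \<partial>M) < ennreal (e / 2)"
    by (auto simp: eventually_sequentially)
  have "finite_fibrewise_approximation M N \<phi> Z f e m A a"
    unfolding finite_fibrewise_approximation_def
  proof (intro conjI allI ballI)
    fix j n
    have "dominated_on M N \<phi> (C j) (A j)"
      using Ba[of j] AB[of j] unfolding fibrewise_approximation_def by (blast intro: dominated_on_subset Am)
    then show "\<exists>C. dominated_on M N \<phi> C (A j)" by blast
    show "a j n \<in> borel_measurable N" "energy N (a j) < \<infinity>"
      using Ba[of j] by (auto simp: fibrewise_approximation_def)
    fix u assume "u \<in> space N"
    then show "(\<forall>n. a j n u = 0) \<or> (\<exists>x \<in> space M - Z. \<phi> x = u \<and> (\<forall>n. a j n u = f n x))"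
      using Ba[of j] by (auto simp: fibrewise_approximation_def)
  next
    have "energy M (\<lambda>n x. f n x - (\<Sum>j<m. indicator (A j) x * a j n (\<phi> x)))
        \<le> (\<integral>\<^sup>+x. ennreal (w x) + sqsum (\<lambda>n. f n x) * indicator (R m) x \<partial>M)"
      unfolding energy_def
    proof (rule nn_integral_mono)
      fix x assume x: "x \<in> space M"
      show "sqsum (\<lambda>n. f n x - (\<Sum>j<m. indicator (A j) x * a j n (\<phi> x)))
          \<le> ennreal (w x) + sqsum (\<lambda>n. f n x) * indicator (R m) x"
      proof (cases "x \<in> R m")
        case True
        then have "(\<Sum>j<m. indicator (A j) x * a j n (\<phi> x)) = 0" for n
          by (intro sum.neutral) (auto simp: R_def)
        then show ?thesis using True by simp
      next
        case False
        then obtain i where i: "i < m" "x \<in> A i" using x by (auto simp: R_def)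
        have "indicator (A j) x * a j n (\<phi> x) = (if j = i then a i n (\<phi> x) else 0)" for j n
          using disj i(2) by (auto simp: disjoint_family_on_def indicator_def)
        then have "(\<Sum>j<m. indicator (A j) x * a j n (\<phi> x)) = a i n (\<phi> x)" for n
          using i(1) by simp
        moreover have "sqsum (\<lambda>n. f n x - a i n (\<phi> x)) \<le> ennreal (w x)"
          using Ba[of i] i(2) AB[of i] by (auto simp: fibrewise_approximation_def)
        ultimately show ?thesis using False by simp
      qed
    qed
    also have "\<dots> = (\<integral>\<^sup>+x. ennreal (w x) \<partial>M) + (\<integral>\<^sup>+x\<in>R m. sqsum (\<lambda>n. f n x) \<partial>M)"
      by (rule nn_integral_add) measurable
    also have "\<dots> \<le> ennreal (e / 2) + ennreal (e / 2)"
      using wint m by (intro add_mono) auto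
    also have "\<dots> = ennreal e" using e by (simp flip: ennreal_plus)
    finally show "energy M (\<lambda>n x. f n x - (\<Sum>j<m. indicator (A j) x * a j n (\<phi> x))) \<le> ennreal e" .
  qed
  then show ?thesis by blast
qed

lemma sqsum_finite_off_null_set:
  assumes "\<And>n. f n \<in> borel_measurable M" "energy M f < \<infinity>"
  obtains Z where "Z \<in> null_sets M" "\<And>x. x \<in> space M - Z \<Longrightarrow> sqsum (\<lambda>n. f n x) < \<infinity>"
proof -
  have "AE x in M. sqsum (\<lambda>n. f n x) \<noteq> \<infinity>"
    using assms by (intro nn_integral_PInf_AE sqsum_measurable) (auto simp: energy_def)
  then obtain Z where "Z \<in> null_sets M" "\<And>x. x \<in> space M - Z \<Longrightarrow> sqsum (\<lambda>n. f n x) \<noteq> \<infinity>"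
    by (auto elim: AE_E3)
  then show thesis by (intro that) (auto simp: less_top)
qed

lemma energy_add_le:
  assumes "\<And>n. a n \<in> borel_measurable M" "\<And>n. b n \<in> borel_measurable M"
  shows "energy M (\<lambda>n x. a n x + b n x) \<le> 2 * energy M a + 2 * energy M b"
proof -
  have "energy M (\<lambda>n x. a n x + b n x) \<le> (\<integral>\<^sup>+x. 2 * sqsum (\<lambda>n. a n x) + 2 * sqsum (\<lambda>n. b n x) \<partial>M)"
    unfolding energy_def by (intro nn_integral_mono sqsum_add_le)
  also have "\<dots> = 2 * energy M a + 2 * energy M b"
    using sqsum_measurable[of a, OF assms(1)] sqsum_measurable[of b, OF assms(2)]
    unfolding energy_def by (simp add: nn_integral_add nn_integral_cmult)
  finally show ?thesis .
qed

lemma sqsum_sum_finite: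
  assumes "finite I" "\<And>i. i \<in> I \<Longrightarrow> sqsum (a i) < \<infinity>"
  shows "sqsum (\<lambda>n. \<Sum>i\<in>I. a i n) < \<infinity>"
  using assms
proof (induction I rule: finite_induct)
  case empty
  show ?case by (simp add: sqsum_def)
next
  case (insert i I)
  have "sqsum (\<lambda>n. \<Sum>i\<in>insert i I. a i n) \<le> 2 * sqsum (a i) + 2 * sqsum (\<lambda>n. \<Sum>i\<in>I. a i n)"
    using insert sqsum_add_le[of "a i" "\<lambda>n. \<Sum>i\<in>I. a i n"] by simp
  also have "\<dots> < \<infinity>" using insert by (simp add: ennreal_mult_less_top)
  finally show ?case .
qed

text \<open>The approximation \<open>H = \<langle>f', g'\<rangle>\<close> of \<open>F = \<langle>f, g\<rangle>\<close> is a finite sum of pulled back functions. The error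
  splits into \<open>\<langle>f - f', g\<rangle>\<close> and \<open>\<langle>f', g - g'\<rangle>\<close>, each with one factor of energy at most \<open>d\<close> and
  another whose energy is bounded independently of \<open>d\<close>.\<close>

lemma Phi_vimage_subset_Phi0:
  fixes M :: "'a measure" and N :: "'b measure" and M1 :: "'c measure" and N1 :: "'d measure"
  assumes M: "standard_borel M" "sigma_finite_measure M" and N: "standard_borel N" "sigma_finite_measure N"
    and M1: "standard_borel M1" "sigma_finite_measure M1" and N1: "standard_borel N1" "sigma_finite_measure N1"
    and \<phi>: "nonsingular_map M M1 \<phi>" and \<psi>: "nonsingular_map N N1 \<psi>"
    and K: "Phi M1 N1 K \<subseteq> Phi0 M1 N1 K"
  shows "Phi M N (prod_vimage M N \<phi> \<psi> K) \<subseteq> Phi0 M N (prod_vimage M N \<phi> \<psi> K)"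
proof
  let ?E = "prod_vimage M N \<phi> \<psi> K"
  fix F assume F: "F \<in> Phi M N ?E"
  have \<phi>m[measurable]: "\<phi> \<in> measurable M M1" and \<psi>m[measurable]: "\<psi> \<in> measurable N N1"
    using \<phi> \<psi> by (auto simp: nonsingular_map_def)
  have FG: "F \<in> Gamma_space M N" and Fv: "vanishes_on M N F ?E" using F by (auto simp: Phi_def)
  from FG obtain c f g where r: "balanced_rep M N (ennreal c) F f g"
    unfolding Gamma_space_iff Gamma_below_def by blast
  have fm[measurable]: "f n \<in> borel_measurable M" and gm[measurable]: "g n \<in> borel_measurable N" for n
    using r by (auto simp: balanced_rep_def)
  have c: "c > 0" by (rule balanced_rep_pos[OF r])
  have ef: "energy M f < ennreal c" and eg: "energy N g < ennreal c" using r by (auto simp: balanced_rep_def)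
  then have ef': "energy M f < \<infinity>" and eg': "energy N g < \<infinity>"
    using ennreal_less_top less_trans unfolding infinity_ennreal_def by blast+
  obtain Z1 where Z1: "Z1 \<in> null_sets M" "\<And>x. x \<in> space M - Z1 \<Longrightarrow> sqsum (\<lambda>n. f n x) < \<infinity>"
    using sqsum_finite_off_null_set[of f M, OF fm ef'] by blast
  obtain W1 where W1: "W1 \<in> null_sets N" "\<And>y. y \<in> space N - W1 \<Longrightarrow> sqsum (\<lambda>n. g n y) < \<infinity>"
    using sqsum_finite_off_null_set[of g N, OF gm eg'] by blast
  have "mae M N (\<lambda>(x, y). (\<lambda>n. f n x * g n y) sums F (x, y))" using r by (simp add: balanced_rep_def)
  from mae_conj[OF this Fv[unfolded vanishes_on_def]]
  obtain Z2 W2 where ZW2: "Z2 \<in> null_sets M" "W2 \<in> null_sets N"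
    and FS2: "\<And>x y. x \<in> space M - Z2 \<Longrightarrow> y \<in> space N - W2 \<Longrightarrow>
      (\<lambda>n. f n x * g n y) sums F (x, y) \<and> F (x, y) * indicator ?E (x, y) = 0"
    unfolding mae_iff by auto
  define Z where "Z = Z1 \<union> Z2"
  define W where "W = W1 \<union> W2"
  have Z: "Z \<in> null_sets M" and W: "W \<in> null_sets N"
    unfolding Z_def W_def by (intro null_sets.Un Z1 W1 ZW2)+
  have fZ: "sqsum (\<lambda>n. f n x) < \<infinity>" if "x \<in> space M - Z" for x using that Z1 by (auto simp: Z_def)
  have gW: "sqsum (\<lambda>n. g n y) < \<infinity>" if "y \<in> space N - W" for y using that W1 by (auto simp: W_def)
  have FS: "(\<lambda>n. f n x * g n y) sums F (x, y)" "F (x, y) * indicator ?E (x, y) = 0"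
    if "x \<in> space M - Z" "y \<in> space N - W" for x y
    using that FS2[of x y] by (auto simp: Z_def W_def)
  show "F \<in> Phi0 M N ?E"
  proof (rule Phi0_closed[OF FG])
    fix e :: real assume e: "e > 0"
    \<comment> \<open>the energies of \<open>f'\<close> and \<open>g\<close> will be at most \<open>2 * c + 2\<close> and \<open>c\<close>; the product of either
      with \<open>d\<close> must be less than \<open>(e / 2)\<^sup>2\<close>\<close>
    define d where "d = min 1 ((e / 2)\<^sup>2 / (2 * c + 3))"
    have "d \<le> (e / 2)\<^sup>2 / (2 * c + 3)" by (simp add: d_def)
    then have "d * (2 * c + 3) \<le> (e / 2)\<^sup>2" using c by (simp add: pos_le_divide_eq)
    then have d: "d > 0" "d \<le> 1" "d * (2 * c + 3) \<le> (e / 2)\<^sup>2"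
      using e c by (auto simp: d_def)
    obtain m A a where "finite_fibrewise_approximation M M1 \<phi> Z f d m A a"
      using ex_finite_fibrewise_approximation[OF M M1 \<phi> fm Z fZ ef' d(1)] by blast
    then have A: "\<And>j. \<exists>C. dominated_on M M1 \<phi> C (A j)"
      and am: "\<And>j n. a j n \<in> borel_measurable M1" and ae: "\<And>j. energy M1 (a j) < \<infinity>"
      and af: "\<And>j u. u \<in> space M1 \<Longrightarrow> (\<forall>n. a j n u = 0) \<or> (\<exists>x \<in> space M - Z. \<phi> x = u \<and> (\<forall>n. a j n u = f n x))"
      and ad: "energy M (\<lambda>n x. f n x - (\<Sum>j<m. indicator (A j) x * a j n (\<phi> x))) \<le> ennreal d"
      unfolding finite_fibrewise_approximation_def by blast+
    obtain m' B b where "finite_fibrewise_approximation N N1 \<psi> W g d m' B b"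
      using ex_finite_fibrewise_approximation[OF N N1 \<psi> gm W gW eg' d(1)] by blast
    then have B: "\<And>l. \<exists>C. dominated_on N N1 \<psi> C (B l)"
      and bm: "\<And>l n. b l n \<in> borel_measurable N1" and be: "\<And>l. energy N1 (b l) < \<infinity>"
      and bg: "\<And>l v. v \<in> space N1 \<Longrightarrow> (\<forall>n. b l n v = 0) \<or> (\<exists>y \<in> space N - W. \<psi> y = v \<and> (\<forall>n. b l n v = g n y))"
      and bd: "energy N (\<lambda>n y. g n y - (\<Sum>l<m'. indicator (B l) y * b l n (\<psi> y))) \<le> ennreal d"
      unfolding finite_fibrewise_approximation_def by blast+
    note [measurable] = am bm
    have [measurable]: "A j \<in> sets M" "B j \<in> sets N" for j using A B by (auto simp: dominated_on_def)
    have afin: "sqsum (\<lambda>n. a j n u) < \<infinity>" if "u \<in> space M1" for j u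
      using af[OF that, of j] fZ by (auto simp: sqsum_def[of "\<lambda>_. 0"])
    have bfin: "sqsum (\<lambda>n. b l n v) < \<infinity>" if "v \<in> space N1" for l v
      using bg[OF that, of l] gW by (auto simp: sqsum_def[of "\<lambda>_. 0"])
    \<comment> \<open>the coefficients of the approximation, as functions downstairs\<close>
    define G where "G j l = (\<lambda>(u, v). \<Sum>n. a j n u * b l n v)" for j l
    have Gs: "(\<lambda>n. a j n u * b l n v) sums G j l (u, v)" if "u \<in> space M1" "v \<in> space N1" for j l u v
      unfolding G_def using summable_sums[OF summable_mult_sqsum[OF afin[OF that(1)] bfin[OF that(2)]]] by simp
    have "G j l \<in> Phi M1 N1 K" for j l
    proof -
      obtain p q where pq: "energy M1 (a j) < ennreal p" "energy N1 (b l) < ennreal q"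
        using ae[of j] be[of l] by (metis ennreal_Ex_less_of_nat ennreal_of_nat_eq_real_of_nat infinity_ennreal_def)
      have "energy M1 (a j) < ennreal (max p q)"
        by (rule less_le_trans[OF pq(1) ennreal_leI]) simp
      moreover have "energy N1 (b l) < ennreal (max p q)"
        by (rule less_le_trans[OF pq(2) ennreal_leI]) simp
      moreover have "mae M1 N1 (\<lambda>(u, v). (\<lambda>n. a j n u * b l n v) sums G j l (u, v))"
        by (rule mae_True) (auto intro: Gs)
      ultimately have "balanced_rep M1 N1 (ennreal (max p q)) (G j l) (a j) (b l)"
        unfolding balanced_rep_def by simp
      then have "G j l \<in> Gamma_space M1 N1" unfolding Gamma_space_iff Gamma_below_def by blast
      moreover have "vanishes_on M1 N1 (G j l) K"
        unfolding vanishes_on_def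
      proof (rule mae_True)
        fix p assume p: "p \<in> space M1 \<times> space N1"
        obtain u v where uv: "p = (u, v)" by force
        have "G j l p = 0" if "p \<in> K"
        proof -
          consider "\<forall>n. a j n u * b l n v = 0"
            | x y where "x \<in> space M - Z" "y \<in> space N - W" "\<phi> x = u" "\<psi> y = v"
              "\<And>n. a j n u * b l n v = f n x * g n y"
            using af[of u j] bg[of v l] p uv by fastforce
          then show ?thesis
          proof cases
            case 1
            have "(\<lambda>n. a j n u * b l n v) = (\<lambda>_. 0)" by (rule ext) (rule 1[rule_format])
            then show ?thesis by (simp add: G_def uv)
          next
            case 2
            then have "(x, y) \<in> ?E" using that uv by auto
            then have "F (x, y) = 0" using FS(2)[OF 2(1,2)] by simp
            then have "(\<lambda>n. a j n u * b l n v) sums 0" using FS(1)[OF 2(1,2)] 2(5) by simp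
            then show ?thesis by (simp add: G_def uv sums_iff)
          qed
        qed
        then show "G j l p * indicator K p = 0" by (auto simp: indicator_def)
      qed
      ultimately show ?thesis by (simp add: Phi_def)
    qed
    note GPhi = this
    have G0: "pullback_on \<phi> \<psi> (A j) (B l) (G j l) \<in> Phi0 M N ?E" for j l
    proof -
      obtain C D where "dominated_on M M1 \<phi> C (A j)" "dominated_on N N1 \<psi> D (B l)"
        using A B by blast
      then show ?thesis by (rule Phi0_pullback[OF \<phi> \<psi>]) (use K GPhi in blast)
    qed
    define f' where "f' n x = (\<Sum>j<m. indicator (A j) x * a j n (\<phi> x))" for n x
    define g' where "g' n y = (\<Sum>l<m'. indicator (B l) y * b l n (\<psi> y))" for n y
    define H where "H p = (\<Sum>j<m. \<Sum>l<m'. pullback_on \<phi> \<psi> (A j) (B l) (G j l) p)" for p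
    have f'm[measurable]: "f' n \<in> borel_measurable M" for n unfolding f'_def[abs_def] by measurable
    have g'm[measurable]: "g' n \<in> borel_measurable N" for n unfolding g'_def[abs_def] by measurable
    have H0: "H \<in> Phi0 M N ?E"
      unfolding H_def[abs_def] by (intro Phi0_sum G0) auto
    have Hs: "(\<lambda>n. f' n x * g' n y) sums H (x, y)" if "x \<in> space M" "y \<in> space N" for x y
    proof -
      have "(\<lambda>n. \<Sum>j<m. \<Sum>l<m'. indicator (A j) x * indicator (B l) y * (a j n (\<phi> x) * b l n (\<psi> y))) sums H (x, y)"
        unfolding H_def pullback_on_def prod.case
        using measurable_space[OF \<phi>m that(1)] measurable_space[OF \<psi>m that(2)]
        by (intro sums_sum sums_mult Gs)
      moreover have "f' n x * g' n y = (\<Sum>j<m. \<Sum>l<m'. indicator (A j) x * indicator (B l) y * (a j n (\<phi> x) * b l n (\<psi> y)))" for n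
        unfolding f'_def g'_def sum_product by (intro sum.cong refl) (simp add: mult_ac)
      ultimately show ?thesis by simp
    qed
    have f'fin: "sqsum (\<lambda>n. f' n x) < \<infinity>" if "x \<in> space M" for x
      unfolding f'_def
    proof (rule sqsum_sum_finite)
      fix j
      show "sqsum (\<lambda>n. indicator (A j) x * a j n (\<phi> x)) < \<infinity>"
        using afin[OF measurable_space[OF \<phi>m that]] by (simp add: sqsum_indicator indicator_def sqsum_def[of "\<lambda>_. 0"])
    qed simp
    have ad': "energy M (\<lambda>n x. f n x - f' n x) \<le> ennreal d" and bd': "energy N (\<lambda>n y. g n y - g' n y) \<le> ennreal d"
      using ad bd by (simp_all add: f'_def g'_def)
    have ef': "energy M f' \<le> ennreal (2 * c + 2)"
    proof -
      have "energy M f' = energy M (\<lambda>n x. f n x + (- (f n x - f' n x)))" by simp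
      also have "\<dots> \<le> 2 * energy M f + 2 * energy M (\<lambda>n x. - (f n x - f' n x))"
        by (rule energy_add_le) measurable
      also have "energy M (\<lambda>n x. - (f n x - f' n x)) = energy M (\<lambda>n x. f n x - f' n x)"
        by (simp only: energy_def sqsum_uminus)
      also have "2 * energy M f + 2 * energy M (\<lambda>n x. f n x - f' n x) \<le> 2 * ennreal c + 2 * ennreal 1"
        using ef order_trans[OF ad' ennreal_leI[OF d(2)]] by (intro add_mono mult_left_mono) auto
      also have "\<dots> = ennreal (2 * c + 2)" using c by (simp add: ennreal_mult)
      finally show ?thesis .
    qed
    define S where "S = (\<lambda>(x, y). \<Sum>n. f' n x * g n y)"
    have Ss: "(\<lambda>n. f' n x * g n y) sums S (x, y)" if "x \<in> space M" "y \<in> space N - W" for x y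
      unfolding S_def using summable_sums[OF summable_mult_sqsum[OF f'fin[OF that(1)] gW[OF that(2)]]] by simp
    \<comment> \<open>\<open>S\<close> is the intermediate pairing of \<open>f'\<close> with \<open>g\<close>\<close>
    have 1: "Gamma_below M N (e / 2) (\<lambda>p. F p - S p)"
    proof (rule Gamma_below_of_energies[of "\<lambda>n x. f n x - f' n x" M g N d c])
      have "d * c < d * (2 * c + 3)" using c d by (intro mult_strict_left_mono) auto
      then show "d * c < (e / 2)\<^sup>2" using d by linarith
      show "mae M N (\<lambda>(x, y). (\<lambda>n. (f n x - f' n x) * g n y) sums (F (x, y) - S (x, y)))"
        unfolding mae_iff
        using sums_diff[OF FS(1) Ss] by (intro bexI[OF _ Z] bexI[OF _ W]) (auto simp: algebra_simps)
    qed (use ad' eg c d e in \<open>auto intro: less_imp_le\<close>)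
    have 2: "Gamma_below M N (e / 2) (\<lambda>p. S p - H p)"
    proof (rule Gamma_below_of_energies[of f' M "\<lambda>n y. g n y - g' n y" N "2 * c + 2" d])
      have "(2 * c + 2) * d < (2 * c + 3) * d" using c d by (intro mult_strict_right_mono) auto
      also have "\<dots> \<le> (e / 2)\<^sup>2" using d(3) by (simp only: mult.commute)
      finally show "(2 * c + 2) * d < (e / 2)\<^sup>2" .
      show "mae M N (\<lambda>(x, y). (\<lambda>n. f' n x * (g n y - g' n y)) sums (S (x, y) - H (x, y)))"
        unfolding mae_iff
        using sums_diff[OF Ss Hs] by (intro bexI[OF _ Z] bexI[OF _ W]) (auto simp: algebra_simps)
    qed (use bd' ef' c d e in auto)
    have "Gamma_below M N e (\<lambda>p. F p - H p)" using Gamma_below_add[OF 1 2] by simp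
    then show "\<exists>G \<in> Phi0 M N ?E. Gamma_below M N e (\<lambda>p. F p - G p)" using H0 by blast
  qed
qed

section \<open>The inverse image theorem\<close>

theorem theorem4p7:
  fixes \<mu> :: "'x measure" and \<nu> :: "'y measure"
    and \<mu>1 :: "'u measure" and \<nu>1 :: "'v measure"
    and \<phi> :: "'x \<Rightarrow> 'u" and \<psi> :: "'y \<Rightarrow> 'v"
    and E1 :: "('u \<times> 'v) set"
  assumes "standard_borel \<mu>" and "standard_borel \<nu>"
    and "standard_borel \<mu>1" and "standard_borel \<nu>1"
    and "sigma_finite_measure \<mu>" and "sigma_finite_measure \<nu>"
    and "sigma_finite_measure \<mu>1" and "sigma_finite_measure \<nu>1"
    and "\<phi> \<in> measurable \<mu> \<mu>1" and "\<psi> \<in> measurable \<nu> \<nu>1"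
    and "absolutely_continuous \<mu>1 (distr \<mu> \<mu>1 \<phi>)"
    and "absolutely_continuous \<nu>1 (distr \<nu> \<nu>1 \<psi>)"
    and "E1 \<in> sets (\<mu>1 \<Otimes>\<^sub>M \<nu>1)"
    and "synthesis_set \<mu>1 \<nu>1 E1"
  shows "synthesis_set \<mu> \<nu> (map_prod \<phi> \<psi> -` E1 \<inter> (space \<mu> \<times> space \<nu>))"
proof -
  have \<phi>: "nonsingular_map \<mu> \<mu>1 \<phi>" and \<psi>: "nonsingular_map \<nu> \<nu>1 \<psi>"
    by (intro nonsingular_map_of_absolutely_continuous assms)+
  have E1: "pseudo_closed \<mu>1 \<nu>1 E1" "Phi \<mu>1 \<nu>1 E1 \<subseteq> Phi0 \<mu>1 \<nu>1 E1"
    using assms(14) by (auto simp: synthesis_set_def)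
  have "Phi \<mu> \<nu> (prod_vimage \<mu> \<nu> \<phi> \<psi> E1) \<subseteq> Phi0 \<mu> \<nu> (prod_vimage \<mu> \<nu> \<phi> \<psi> E1)"
    by (rule Phi_vimage_subset_Phi0[OF assms(1,5,2,6,3,7,4,8) \<phi> \<psi> E1(2)])
  then show ?thesis
    unfolding synthesis_set_def
    using pseudo_closed_vimage[OF \<phi> \<psi> E1(1)] Phi0_subset_Phi by blast
qed

end
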